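(* Every finite, connected, simple bipartite graph $G_0$ admits a unique canonical decomposition into induced subgraphs, called atomic blocks, arranged in a block triangular form (BTF), with the following properties. (1) Each block is atomic: it is $m$-atomic for some $m>0$, that is, connected and $m$-excessive. The value of $m$ may differ between blocks. (2) The decomposition refines the classical Dulmage–Mendelsohn (DM) structure in two steps. First, the excessive decomposition partitions $G_0$ into blocks $D,C_1,\dots,C_k,E$ arranged in BTF, where each block is excessive. The square blocks $C_1,\dots,C_k$ are balanced and excessive, hence connected and atomic. The blocks $D$ and $E$ are excessive but not necessarily connected. Second, the atomic decomposition refines $D$ and $E$ by decomposing the induced subgraphs $G_0[D]$ and $G_0[E]$ into their connected components $D_1,\dots,D_p$ and $E_1,\dots,E_q$ respectively; each such component is unbalanced and excessive, hence atomic. (3) Edges between atomic blocks from different regions may exist in $G_0$, but are forbidden with respect to every maximum matching of $G_0$ (no such edge belongs to any maximum matching). (4) Every maximum matching of $G_0$ is the disjoint union of maximum matchings of the individual atomic blocks. Each block $T$, being excessive, satisfies the hole condition (it has no hole of vcount greater than $\mathrm{long}(T)$) and hence admits a matching of size $\mathrm{small}(T)$. No edges between blocks from different regions belong to any maximum matching. (5) The decomposition is invariant under the choice of maximum matching and under the choice of maximum hole in the excessive decomposition. In particular, the set of atomic blocks is uniquely determined; the blocks are arranged in a BTF that is unique up to permutation of topologically incomparable blocks.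
   Context: $G_0$ has colour classes $A$ and $B$, no isolated vertices, $|A|\le|B|$, and is not complete bipartite. A brick is $T=Y\times X$ with nonempty $Y\subseteq B$ (rows, $\mathrm{row}(T)=Y$) and nonempty $X\subseteq A$ (columns, $\mathrm{col}(T)=X$), identified with the induced subgraph $G_0[X\cup Y]$; there is a dot in cell $(y,x)$ exactly when $xy$ is an edge. Put $\mathrm{vcount}(T)=|X|+|Y|$, $\mathrm{long}(T)=\max\{|X|,|Y|\}$, $\mathrm{small}(T)=\min\{|X|,|Y|\}$. $T$ is balanced (square) if $|X|=|Y|$, horizontal if $|X|>|Y|$, vertical if $|X|<|Y|$; unbalanced means not balanced. A hole of $T$ is a dot-free sub-brick $Y'\times X'$ with $\emptyset\ne Y'\subsetneq Y$ and $\emptyset\neq X'\subsetneq X$; a maximum hole is one of maximum vcount. Let $\alpha_p(T)$ be the maximum vcount of a hole of $T$ ($0$ if there is none); equivalently, the maximum size of an independent set of $T$ that meets both sides and contains neither. The characteristic of $T$ is $m=|\mathrm{row}(T)|-\alpha_p(T)$, under the convention that the rows form the longer side; for a horizontal brick the roles of rows and columns are interchanged. $T$ is $m$-excessive (excessive) if $m>0$, and $m$-atomic (atomic) if it is connected and $m$-excessive with $m>0$. An ordered partition into bricks $B_1,\dots,B_r$ is a BTF if all edges between distinct blocks run forward, i.e. there are no edges from $B_i$ to $B_j$ for $i>j$. In the grid, with the blocks placed along the diagonal from the lower left (first block) to the upper right (last block), this means that in the vertical strip $B\times\mathrm{col}(B_j)$ of each block there are no dots above the block. Two blocks are topologically comparable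 if there is a sequence of blocks, of increasing position in the BTF, from one to the other in which consecutive blocks are joined by an edge; otherwise they are incomparable. The excessive decomposition of $G_0$ is a BTF partition, in this order, into excessive induced subgraphs $D,C_1,\dots,C_k,E$ (any may be absent) with $D$ horizontal, each $C_i$ balanced and $E$ vertical. It is produced recursively from $T_0=B\times A$: a brick $T$ with no hole of vcount $\ge\mathrm{long}(T)$ is a block; otherwise choose a maximum hole $V$ of $T$ and recurse first on $(\mathrm{row}(T)\setminus\mathrm{row}(V))\times\mathrm{col}(V)$, then on $\mathrm{row}(V)\times(\mathrm{col}(T)\setminus\mathrm{col}(V))$, listing blocks in the order found. The classical DM decomposition partitions the vertices of $G_0$ into three regions: for a maximum matching $M$, the $D$-region consists of the vertices reachable by $M$-alternating paths from $M$-unmatched vertices of $A$, the $E$-region of those reachable by $M$-alternating paths from $M$-unmatched vertices of $B$, and the $C$-region of the remaining vertices; it does not depend on $M$. The regions are $D$, $C$ (containing the blocks $C_1,\dots,C_k$) and $E$. *)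

theory Defs
  imports Main
begin

section \<open>Bipartite graphs and matchings\<close>

text \<open>
  A graph is given by its colour classes \<open>A\<close> (columns), \<open>B\<close> (rows) and its set \<open>E\<close> of edges,
  each edge being a two-element set of vertices.
\<close>

definition bipartite_graph :: "'a set \<Rightarrow> 'a set \<Rightarrow> 'a set set \<Rightarrow> bool" where
  "bipartite_graph A B E \<longleftrightarrow>
     finite A \<and> finite B \<and> A \<inter> B = {} \<and> E \<subseteq> {{x, y} | x y. x \<in> A \<and> y \<in> B}"

definition connection :: "'a set set \<Rightarrow> 'a set \<Rightarrow> ('a \<times> 'a) set" where
  "connection E W = ({(u, v). {u, v} \<in> E} \<inter> W \<times> W)\<^sup>*"

definition connected_on :: "'a set set \<Rightarrow> 'a set \<Rightarrow> bool" where
  "connected_on E W \<longleftrightarrow> W \<noteq> {} \<and> (\<forall>u\<in>W. \<forall>v\<in>W. (u, v) \<in> connection E W)"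

definition base_graph :: "'a set \<Rightarrow> 'a set \<Rightarrow> 'a set set \<Rightarrow> bool" where
  "base_graph A B E \<longleftrightarrow>
     bipartite_graph A B E \<and>
     connected_on E (A \<union> B) \<and>
     (\<forall>v\<in>A \<union> B. \<exists>e\<in>E. v \<in> e) \<and>
     card A \<le> card B \<and>
     \<not> (\<forall>x\<in>A. \<forall>y\<in>B. {x, y} \<in> E)"

definition matching :: "'a set set \<Rightarrow> 'a set set \<Rightarrow> bool" where
  "matching E M \<longleftrightarrow> M \<subseteq> E \<and> (\<forall>e\<in>M. \<forall>f\<in>M. e \<noteq> f \<longrightarrow> e \<inter> f = {})"

definition maximum_matching :: "'a set set \<Rightarrow> 'a set set \<Rightarrow> bool" where
  "maximum_matching E M \<longleftrightarrow> matching E M \<and> (\<forall>N. matching E N \<longrightarrow> card N \<le> card M)"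


section \<open>The Dulmage--Mendelsohn regions\<close>

definition alternating_path :: "'a set set \<Rightarrow> 'a set set \<Rightarrow> 'a list \<Rightarrow> bool" where
  "alternating_path E M p \<longleftrightarrow>
     p \<noteq> [] \<and> distinct p \<and>
     (\<forall>i. i + 1 < length p \<longrightarrow> {p ! i, p ! (i + 1)} \<in> E) \<and>
     (\<forall>i. i + 2 < length p \<longrightarrow>
        ({p ! i, p ! (i + 1)} \<in> M \<longleftrightarrow> {p ! (i + 1), p ! (i + 2)} \<notin> M))"

text \<open>Paths of length zero are allowed, so the unmatched vertices themselves are reachable.\<close>

definition alternating_reach :: "'a set set \<Rightarrow> 'a set set \<Rightarrow> 'a set \<Rightarrow> 'a set" where
  "alternating_reach E M S =
     {v. \<exists>p. alternating_path E M p \<and> hd p \<in> S - \<Union>M \<and> last p = v}"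

definition dm_D :: "'a set \<Rightarrow> 'a set \<Rightarrow> 'a set set \<Rightarrow> 'a set set \<Rightarrow> 'a set" where
  "dm_D A B E M = alternating_reach E M A"

definition dm_E :: "'a set \<Rightarrow> 'a set \<Rightarrow> 'a set set \<Rightarrow> 'a set set \<Rightarrow> 'a set" where
  "dm_E A B E M = alternating_reach E M B"

definition dm_C :: "'a set \<Rightarrow> 'a set \<Rightarrow> 'a set set \<Rightarrow> 'a set set \<Rightarrow> 'a set" where
  "dm_C A B E M = (A \<union> B) - dm_D A B E M - dm_E A B E M"

definition dm_regions :: "'a set \<Rightarrow> 'a set \<Rightarrow> 'a set set \<Rightarrow> 'a set set \<Rightarrow> 'a set set" where
  "dm_regions A B E M = {dm_D A B E M, dm_C A B E M, dm_E A B E M}"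


section \<open>Bricks and holes\<close>

text \<open>\<open>Brick Y X\<close> is the brick \<open>Y \<times> X\<close>.\<close>

datatype 'a brick = Brick (row: "'a set") (col: "'a set")

definition is_brick :: "'a set \<Rightarrow> 'a set \<Rightarrow> 'a brick \<Rightarrow> bool" where
  "is_brick A B T \<longleftrightarrow> row T \<noteq> {} \<and> row T \<subseteq> B \<and> col T \<noteq> {} \<and> col T \<subseteq> A"

definition verts :: "'a brick \<Rightarrow> 'a set" where
  "verts T = col T \<union> row T"

definition induced_edges :: "'a set set \<Rightarrow> 'a brick \<Rightarrow> 'a set set" where
  "induced_edges E T = {e \<in> E. e \<subseteq> verts T}"

definition vcount :: "'a brick \<Rightarrow> nat" where
  "vcount T = card (col T) + card (row T)"

definition long :: "'a brick \<Rightarrow> nat" where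
  "long T = max (card (col T)) (card (row T))"

definition small :: "'a brick \<Rightarrow> nat" where
  "small T = min (card (col T)) (card (row T))"

definition balanced :: "'a brick \<Rightarrow> bool" where
  "balanced T \<longleftrightarrow> card (col T) = card (row T)"

definition horizontal :: "'a brick \<Rightarrow> bool" where
  "horizontal T \<longleftrightarrow> card (col T) > card (row T)"

definition vertical :: "'a brick \<Rightarrow> bool" where
  "vertical T \<longleftrightarrow> card (col T) < card (row T)"

definition hole :: "'a set set \<Rightarrow> 'a brick \<Rightarrow> 'a brick \<Rightarrow> bool" where
  "hole E T V \<longleftrightarrow>
     row V \<noteq> {} \<and> row V \<subset> row T \<and> col V \<noteq> {} \<and> col V \<subset> col T \<and>
     (\<forall>x\<in>col V. \<forall>y\<in>row V. {x, y} \<notin> E)"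

definition maximum_hole :: "'a set set \<Rightarrow> 'a brick \<Rightarrow> 'a brick \<Rightarrow> bool" where
  "maximum_hole E T V \<longleftrightarrow> hole E T V \<and> (\<forall>W. hole E T W \<longrightarrow> vcount W \<le> vcount V)"

definition alpha_p :: "'a set set \<Rightarrow> 'a brick \<Rightarrow> nat" where
  "alpha_p E T = (if \<exists>V. hole E T V then Max (vcount ` {V. hole E T V}) else 0)"

definition characteristic :: "'a set set \<Rightarrow> 'a brick \<Rightarrow> int" where
  "characteristic E T =
     int (if horizontal T then card (col T) else card (row T)) - int (alpha_p E T)"

definition m_excessive :: "'a set set \<Rightarrow> int \<Rightarrow> 'a brick \<Rightarrow> bool" where
  "m_excessive E m T \<longleftrightarrow> m > 0 \<and> characteristic E T = m"

definition excessive :: "'a set set \<Rightarrow> 'a brick \<Rightarrow> bool" where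
  "excessive E T \<longleftrightarrow> (\<exists>m. m_excessive E m T)"

definition m_atomic :: "'a set set \<Rightarrow> int \<Rightarrow> 'a brick \<Rightarrow> bool" where
  "m_atomic E m T \<longleftrightarrow> connected_on E (verts T) \<and> m_excessive E m T"

definition atomic :: "'a set set \<Rightarrow> 'a brick \<Rightarrow> bool" where
  "atomic E T \<longleftrightarrow> (\<exists>m. m_atomic E m T)"

definition hole_condition :: "'a set set \<Rightarrow> 'a brick \<Rightarrow> bool" where
  "hole_condition E T \<longleftrightarrow> \<not> (\<exists>V. hole E T V \<and> vcount V > long T)"


section \<open>Block triangular forms\<close>

text \<open>
  An edge \<open>{x, y}\<close> with row \<open>y\<close> in \<open>S\<close> and column \<open>x\<close> in \<open>T\<close> runs from \<open>S\<close> to \<open>T\<close>. So no dot lies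
  in a column of a block and a row of a later block.
\<close>

definition btf :: "'a set \<Rightarrow> 'a set \<Rightarrow> 'a set set \<Rightarrow> 'a brick list \<Rightarrow> bool" where
  "btf A B E L \<longleftrightarrow>
     (\<forall>T\<in>set L. is_brick A B T) \<and>
     (\<Union>T\<in>set L. verts T) = A \<union> B \<and>
     sorted_wrt (\<lambda>S T. verts S \<inter> verts T = {} \<and>
       \<not> (\<exists>y\<in>row T. \<exists>x\<in>col S. {x, y} \<in> E)) L"

definition joined :: "'a set set \<Rightarrow> 'a brick \<Rightarrow> 'a brick \<Rightarrow> bool" where
  "joined E S T \<longleftrightarrow> (\<exists>u\<in>verts S. \<exists>v\<in>verts T. {u, v} \<in> E)"

text \<open>Comparability of the blocks at two positions of an ordered list of blocks.\<close>

definition comparable :: "'a set set \<Rightarrow> 'a brick list \<Rightarrow> nat \<Rightarrow> nat \<Rightarrow> bool" where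
  "comparable E L i j \<longleftrightarrow>
     (let R = {(k, l). k < l \<and> l < length L \<and> joined E (L ! k) (L ! l)}
      in (i, j) \<in> R\<^sup>* \<or> (j, i) \<in> R\<^sup>*)"

text \<open>
  \<open>L'\<close> arises from \<open>L\<close> by permuting incomparable blocks: only pairs of blocks that are
  incomparable in \<open>L\<close> may change their relative order. \<open>\<pi> i\<close> is the new position of the \<open>i\<close>-th block.
\<close>

definition incomparable_permutation ::
    "'a set set \<Rightarrow> 'a brick list \<Rightarrow> 'a brick list \<Rightarrow> bool" where
  "incomparable_permutation E L L' \<longleftrightarrow>
     length L' = length L \<and>
     (\<exists>\<pi>. bij_betw \<pi> {..<length L} {..<length L} \<and>
        (\<forall>i<length L. L' ! \<pi> i = L ! i) \<and>
        (\<forall>i j. i < j \<and> j < length L \<and> comparable E L i j \<longrightarrow> \<pi> i < \<pi> j))"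


section \<open>The excessive and the atomic decomposition\<close>

text \<open>
  \<open>decomposes E T L\<close>: some run of the recursion on the brick \<open>T\<close> (for some choice of the maximum
  holes) lists the blocks \<open>L\<close>.
\<close>

inductive decomposes :: "'a set set \<Rightarrow> 'a brick \<Rightarrow> 'a brick list \<Rightarrow> bool"
  for E :: "'a set set" where
  block: "\<not> (\<exists>V. hole E T V \<and> vcount V \<ge> long T) \<Longrightarrow> decomposes E T [T]"
| split: "\<exists>W. hole E T W \<and> vcount W \<ge> long T \<Longrightarrow> maximum_hole E T V \<Longrightarrow>
    decomposes E (Brick (row T - row V) (col V)) L1 \<Longrightarrow>
    decomposes E (Brick (row V) (col T - col V)) L2 \<Longrightarrow>
    decomposes E T (L1 @ L2)"

definition excessive_decomposition ::
    "'a set \<Rightarrow> 'a set \<Rightarrow> 'a set set \<Rightarrow> 'a brick list \<Rightarrow> bool" where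
  "excessive_decomposition A B E L \<longleftrightarrow> decomposes E (Brick B A) L"

definition component_bricks :: "'a set set \<Rightarrow> 'a brick \<Rightarrow> 'a brick set" where
  "component_bricks E T =
     {Brick (row T \<inter> K) (col T \<inter> K) | K. K \<in> verts T // connection E (verts T)}"

definition atomic_blocks :: "'a set set \<Rightarrow> 'a brick list \<Rightarrow> 'a brick set" where
  "atomic_blocks E L =
     {T \<in> set L. balanced T} \<union> (\<Union>T\<in>{T \<in> set L. \<not> balanced T}. component_bricks E T)"

definition atomic_decomposition ::
    "'a set \<Rightarrow> 'a set \<Rightarrow> 'a set set \<Rightarrow> 'a brick set \<Rightarrow> bool" where
  "atomic_decomposition A B E \<B> \<longleftrightarrow>
     (\<exists>L. excessive_decomposition A B E L \<and> \<B> = atomic_blocks E L)"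

definition different_regions ::
    "'a set \<Rightarrow> 'a set \<Rightarrow> 'a set set \<Rightarrow> 'a brick \<Rightarrow> 'a brick \<Rightarrow> bool" where
  "different_regions A B E S T \<longleftrightarrow>
     (\<exists>M R R'. maximum_matching E M \<and> R \<in> dm_regions A B E M \<and> R' \<in> dm_regions A B E M \<and>
        R \<noteq> R' \<and> verts S \<subseteq> R \<and> verts T \<subseteq> R')"

end

theory Submission
  imports Defs
begin

text \<open>
  Call \<open>F\<close> closed if it contains all neighbours of the columns in \<open>F\<close>, and call
  \<open>card (A \<inter> F) - card (B \<inter> F)\<close> its gain. The gain is modular, so the closed sets of maximum gain,
  the tight ones, form a lattice. Between two consecutive elements of a chain of tight sets a maximum
  hole whose vcount is at least the long side is the same as a further tight set. Hence every run of
  the recursion produces a maximal chain from the empty set to \<open>A \<union> B\<close>, and its blocks are the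
  classes of vertices that no tight set separates; these do not depend on the run.

  By Hall's theorem applied to the two sides of a tight set \<open>F\<close>, a maximum matching has as many
  edges as the vertex cover \<open>(B \<inter> F) \<union> (A - F)\<close>. So it saturates this cover and has no edge across
  \<open>F\<close>, which confines its edges to the blocks. The vertices reachable by alternating paths from
  unmatched columns form the least tight set, and dually for the rows, which identifies the regions.

  Inside a block the holes between a connected component and the rest of the block show that
  balanced blocks are connected and that the components of an unbalanced block are excessive and
  unbalanced.
\<close>

section \<open>Hall's theorem and connected components\<close>

text \<open>The obstacle is twofold: a hole must be nonempty and proper on both sides, so it is not
  just an independent set, and the two ends of the recursion, the empty set and the whole vertex
  set, need not be tight. The proof therefore works with the tight sets together with these two
  ends. Adjoining a bottom and a top keeps the lattice, and only the first and the last step of a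
  chain can have an end that is not tight. There the gain strictly rises or falls, which is the
  origin of \<open>D\<close> and \<open>E\<close>; between tight sets it is constant, and the block
  is square. The absence of isolated vertices closes the gap between holes and independent sets: a
  vertex without neighbour in its own block still has one in the graph, which forces an end of the
  block to be tight, and moving the vertex across that end would raise the gain above its
  maximum.\<close>

lemma hall:
  fixes S :: "'i \<Rightarrow> 'b set"
  assumes "finite I" "\<And>i. i \<in> I \<Longrightarrow> finite (S i)"
    and "\<And>J. J \<subseteq> I \<Longrightarrow> card J \<le> card (\<Union>i\<in>J. S i)"
  shows "\<exists>f. inj_on f I \<and> (\<forall>i\<in>I. f i \<in> S i)"
  using assms
proof (induction "card I" arbitrary: I S rule: less_induct)
  case less
  show ?case
  proof (cases "I = {}")
    case True
    then show ?thesis by auto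
  next
    case False
    have finU: "finite (\<Union>i\<in>J. S i)" if "J \<subseteq> I" for J
      using that less.prems by (auto intro: finite_subset)
    show ?thesis
    \<comment> \<open>Induction in the style of Halmos and Vaughan: a proper subfamily that meets
      Hall's condition with equality is served first; without one, every proper nonempty subfamily
      has an element to spare.\<close>
    proof (cases "\<exists>J. J \<noteq> {} \<and> J \<subset> I \<and> card (\<Union>i\<in>J. S i) = card J")
      case True
      then obtain J where J: "J \<noteq> {}" "J \<subset> I" "card (\<Union>i\<in>J. S i) = card J" by blast
      have finJ: "finite J" using J(2) less.prems(1) finite_subset by blast
      let ?U = "\<Union>i\<in>J. S i"
      have "\<exists>f. inj_on f J \<and> (\<forall>i\<in>J. f i \<in> S i)"
      proof (rule less.hyps)
        show "card J < card I" using J less.prems(1) psubset_card_mono by blast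
      qed (use J finJ less.prems in auto)
      then obtain f where f: "inj_on f J" "\<forall>i\<in>J. f i \<in> S i" by blast
      \<comment> \<open>Hall's condition survives the removal of \<open>?U\<close>: for
        \<open>K \<union> J\<close> it counts \<open>?U\<close>, of size \<open>card J\<close>,
        together with what is left for \<open>K\<close>.\<close>
      have "\<exists>g. inj_on g (I - J) \<and> (\<forall>i\<in>I - J. g i \<in> S i - ?U)"
      proof (rule less.hyps)
        show "card (I - J) < card I"
          using J less.prems(1) by (intro psubset_card_mono) auto
        fix K assume K: "K \<subseteq> I - J"
        have finK: "finite K" using K less.prems(1) by (auto intro: finite_subset)
        have "card K + card J = card (K \<union> J)"
          using K finK finJ by (subst card_Un_disjoint) auto
        also have "\<dots> \<le> card (\<Union>i\<in>K \<union> J. S i)" using K J by (intro less.prems(3)) auto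
        also have "(\<Union>i\<in>K \<union> J. S i) = (\<Union>i\<in>K. S i - ?U) \<union> ?U" by auto
        also have "card \<dots> = card (\<Union>i\<in>K. S i - ?U) + card ?U"
          using finU[of J] finU[of K] K J
          by (intro card_Un_disjoint) (auto intro: rev_finite_subset)
        finally show "card K \<le> card (\<Union>i\<in>K. S i - ?U)" using J(3) by simp
      qed (use less.prems in auto)
      then obtain g where g: "inj_on g (I - J)" "\<forall>i\<in>I - J. g i \<in> S i - ?U" by blast
      let ?h = "\<lambda>i. if i \<in> J then f i else g i"
      have "inj_on ?h I"
      proof (rule inj_onI)
        fix i j assume ij: "i \<in> I" "j \<in> I" "?h i = ?h j"
        show "i = j"
        proof (cases "i \<in> J \<longleftrightarrow> j \<in> J")
          case True
          then show ?thesis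
            using ij inj_onD[OF f(1), of i j] inj_onD[OF g(1), of i j] by (cases "i \<in> J") auto
        next
          case False
          have "?h k \<in> ?U \<longleftrightarrow> k \<in> J" if "k \<in> I" for k using that f(2) g(2) by auto
          then show ?thesis using False ij by metis
        qed
      qed
      moreover have "\<forall>i\<in>I. ?h i \<in> S i" using f g by auto
      ultimately show ?thesis by blast
    next
      case False
      note F = this
      obtain i where i: "i \<in> I" using \<open>I \<noteq> {}\<close> by blast
      have "S i \<noteq> {}" using less.prems(3)[of "{i}"] i by auto
      then obtain a where a: "a \<in> S i" by blast
      have "\<exists>g. inj_on g (I - {i}) \<and> (\<forall>j\<in>I - {i}. g j \<in> S j - {a})"
      proof (rule less.hyps)
        show "card (I - {i}) < card I" using i less.prems(1) by (intro card_Diff1_less) auto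
        fix K assume K: "K \<subseteq> I - {i}"
        show "card K \<le> card (\<Union>j\<in>K. S j - {a})"
        proof (cases "K = {}")
          case False
          have "card K \<noteq> card (\<Union>j\<in>K. S j)" using F False K i by (metis Diff_iff insertI1 psubsetI subset_iff)
          moreover have "card K \<le> card (\<Union>j\<in>K. S j)" using K by (intro less.prems(3)) auto
          moreover have "(\<Union>j\<in>K. S j - {a}) = (\<Union>j\<in>K. S j) - {a}" by auto
          ultimately show ?thesis using finU[of K] K by (auto simp: card_Diff_singleton_if)
        qed simp
      qed (use less.prems in auto)
      then obtain g where g: "inj_on g (I - {i})" "\<forall>j\<in>I - {i}. g j \<in> S j - {a}" by blast
      let ?h = "g(i := a)"
      have "inj_on ?h I"
        using g by (auto simp: inj_on_def)
      moreover have "\<forall>j\<in>I. ?h j \<in> S j" using g a by auto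
      ultimately show ?thesis by blast
    qed
  qed
qed

section \<open>Reachability inside an induced subgraph\<close>

lemma connection_sym: "(u, v) \<in> connection E W \<Longrightarrow> (v, u) \<in> connection E W"
proof -
  have "sym ({(u, v). {u, v} \<in> E} \<inter> W \<times> W)"
    by (auto simp: sym_def insert_commute)
  then show "(u, v) \<in> connection E W \<Longrightarrow> (v, u) \<in> connection E W"
    unfolding connection_def using sym_rtrancl symD by metis
qed

lemma connection_trans:
  "(u, v) \<in> connection E W \<Longrightarrow> (v, w) \<in> connection E W \<Longrightarrow> (u, w) \<in> connection E W"
  unfolding connection_def by (rule rtrancl_trans)

lemma connection_refl: "(u, u) \<in> connection E W"
  unfolding connection_def by simp

lemma connection_edge:
  "{u, v} \<in> E \<Longrightarrow> u \<in> W \<Longrightarrow> v \<in> W \<Longrightarrow> (u, v) \<in> connection E W"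
  unfolding connection_def by auto

lemma connection_closed:
  assumes "(u, v) \<in> connection E W" "u \<in> K"
    and "\<And>s t. s \<in> K \<Longrightarrow> t \<in> W \<Longrightarrow> {s, t} \<in> E \<Longrightarrow> t \<in> K"
  shows "v \<in> K"
  using assms(1) unfolding connection_def
  by (induction rule: rtrancl_induct) (use assms in auto)

lemma connection_within:
  assumes "(u, v) \<in> connection E W" "u \<in> W"
  shows "v \<in> W"
  using assms connection_closed by metis

lemma component_props:
  assumes "K \<in> W // connection E W"
  shows "K \<subseteq> W" "K \<noteq> {}" "connected_on E K"
    and "\<And>u v. u \<in> K \<Longrightarrow> v \<in> W \<Longrightarrow> {u, v} \<in> E \<Longrightarrow> v \<in> K"
proof -
  obtain a where a: "a \<in> W" "K = connection E W `` {a}"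
    using assms by (auto simp: quotient_def)
  have mem: "v \<in> K \<longleftrightarrow> (a, v) \<in> connection E W" for v using a(2) by simp
  show KW: "K \<subseteq> W" using a(1) mem connection_within[of a _ E W] by blast
  show Kne: "K \<noteq> {}" using mem[of a] connection_refl[of a E W] by blast
  have step_in: "v \<in> K" if "u \<in> K" "v \<in> W" "{u, v} \<in> E" for u v
    using that KW mem connection_edge[of u v E W] connection_trans[of a u E W v] by blast
  show "\<And>u v. u \<in> K \<Longrightarrow> v \<in> W \<Longrightarrow> {u, v} \<in> E \<Longrightarrow> v \<in> K" by (rule step_in)
  \<comment> \<open>Connectedness of \<open>K\<close> asks for paths inside \<open>K\<close>, while
    the class was formed with paths inside \<open>W\<close>; by closure under edges such a path
    never leaves \<open>K\<close>.\<close>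
  have reach: "(a, v) \<in> connection E K" if "(a, v) \<in> connection E W" for v
    using that unfolding connection_def[of E W]
  proof (induction rule: rtrancl_induct)
    case base
    show ?case by (rule connection_refl)
  next
    case (step y z)
    have "y \<in> K" using step(1) mem by (simp add: connection_def)
    moreover from this have "z \<in> K" using step_in step(2) by auto
    ultimately have "(y, z) \<in> connection E K" using step(2) connection_edge by auto
    with step.IH show ?case by (rule connection_trans)
  qed
  show "connected_on E K"
    unfolding connected_on_def
  proof (intro conjI ballI)
    show "K \<noteq> {}" by (rule Kne)
    fix u v assume "u \<in> K" "v \<in> K"
    then have "(a, u) \<in> connection E K" "(a, v) \<in> connection E K" using reach mem by auto
    then show "(u, v) \<in> connection E K"
      using connection_sym[of a u E K] connection_trans[of u a E K v] by blast
  qed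
qed

lemma component_eq_or_disjoint:
  assumes "K \<in> W // connection E W" "K' \<in> W // connection E W"
  shows "K = K' \<or> K \<inter> K' = {}"
proof -
  \<comment> \<open>Being a reflexive closure, \<open>connection E W\<close> also relates the
    vertices outside \<open>W\<close> to themselves, so it is an equivalence on \<open>UNIV\<close>
    rather than on \<open>W\<close>.\<close>
  have "equiv UNIV (connection E W)"
  proof (rule equivI)
    show "refl_on UNIV (connection E W)" using connection_refl by (rule refl_onI)
    show "sym (connection E W)" using connection_sym by (rule symI)
    show "trans (connection E W)" using connection_trans by (rule transI)
  qed simp
  moreover have "K \<in> UNIV // connection E W" "K' \<in> UNIV // connection E W"
    using assms by (auto simp: quotient_def)
  ultimately show ?thesis by (rule quotient_disj)
qed

lemma component_exists:
  assumes "v \<in> W"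
  shows "\<exists>K\<in>W // connection E W. v \<in> K"
  using assms connection_refl[of v E W] by (auto simp: quotient_def)

lemma components_connected:
  assumes "connected_on E W"
  shows "W // connection E W = {W}"
proof -
  have "connection E W `` {a} = W" if "a \<in> W" for a
    using assms that connection_within[of a _ E W] unfolding connected_on_def by blast
  then show ?thesis using assms by (auto simp: quotient_def connected_on_def)
qed

section \<open>Components as bricks\<close>

lemma verts_eq_empty_iff: "verts T = {} \<longleftrightarrow> row T = {} \<and> col T = {}"
  by (auto simp: verts_def)

lemma brick_Int_verts: "Brick (row T \<inter> verts T) (col T \<inter> verts T) = T"
  by (cases T) (auto simp: verts_def)

lemma verts_component: "K \<subseteq> verts T \<Longrightarrow> verts (Brick (row T \<inter> K) (col T \<inter> K)) = K"
  by (auto simp: verts_def)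

lemma component_bricks_connected:
  assumes "connected_on E (verts T)"
  shows "component_bricks E T = {T}"
  using components_connected[OF assms] by (auto simp: component_bricks_def brick_Int_verts)

lemma component_bricksE:
  assumes "S \<in> component_bricks E T"
  obtains "verts S \<in> verts T // connection E (verts T)"
    "row S = row T \<inter> verts S" "col S = col T \<inter> verts S"
proof -
  obtain K where K: "K \<in> verts T // connection E (verts T)" "S = Brick (row T \<inter> K) (col T \<inter> K)"
    using assms by (auto simp: component_bricks_def)
  then have "verts S = K" using component_props(1) verts_component by metis
  then show ?thesis using K that by auto
qed

lemma component_bricks_cover:
  assumes "v \<in> verts T"
  shows "\<exists>S\<in>component_bricks E T. v \<in> verts S"
proof -
  obtain K where "K \<in> verts T // connection E (verts T)" "v \<in> K"
    using component_exists[OF assms] by blast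
  then show ?thesis
    using component_props(1)[of K] verts_component[of K T] by (auto simp: component_bricks_def)
qed

lemma component_bricks_disjoint:
  assumes "S \<in> component_bricks E T" "S' \<in> component_bricks E T" "S \<noteq> S'"
  shows "verts S \<inter> verts S' = {}"
  using assms component_eq_or_disjoint brick.expand by (metis component_bricksE)

section \<open>Bricks without large holes\<close>

text \<open>The stopping condition of the recursion. It is stronger than
  \<open>hole_condition\<close>, which still admits a hole of vcount exactly
  \<open>long T\<close>.\<close>

definition solid :: "'a set set \<Rightarrow> 'a brick \<Rightarrow> bool" where
  "solid E T \<longleftrightarrow> \<not> (\<exists>V. hole E T V \<and> vcount V \<ge> long T)"

definition transpose :: "'a brick \<Rightarrow> 'a brick" where
  "transpose T = Brick (col T) (row T)"

lemma transpose_simps [simp]: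
  "row (transpose T) = col T" "col (transpose T) = row T" "transpose (transpose T) = T"
  "verts (transpose T) = verts T" "vcount (transpose T) = vcount T" "long (transpose T) = long T"
  by (cases T; auto simp: transpose_def verts_def vcount_def long_def)+

lemma hole_transpose: "hole E (transpose T) (transpose V) \<longleftrightarrow> hole E T V"
proof -
  have "(\<forall>x\<in>P. \<forall>y\<in>Q. {x, y} \<notin> E) \<longleftrightarrow> (\<forall>x\<in>Q. \<forall>y\<in>P. {x, y} \<notin> E)" for P Q
    by (metis insert_commute)
  then show ?thesis by (auto simp: hole_def)
qed

lemma solid_transpose: "solid E (transpose T) \<longleftrightarrow> solid E T"
  unfolding solid_def by (metis hole_transpose transpose_simps(3,5,6))

lemma component_bricks_transpose:
  "component_bricks E (transpose T) = transpose ` component_bricks E T"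
proof -
  have "component_bricks E (transpose T) =
      (\<lambda>K. transpose (Brick (row T \<inter> K) (col T \<inter> K))) ` (verts T // connection E (verts T))"
    unfolding component_bricks_def transpose_simps by (auto simp: transpose_def)
  then show ?thesis unfolding component_bricks_def by auto
qed

lemma finite_holes:
  assumes "finite (row T)" "finite (col T)"
  shows "finite {V. hole E T V}"
proof (rule finite_subset)
  show "{V. hole E T V} \<subseteq> (\<lambda>(Y, X). Brick Y X) ` (Pow (row T) \<times> Pow (col T))"
  proof
    fix V assume "V \<in> {V. hole E T V}"
    then have "(row V, col V) \<in> Pow (row T) \<times> Pow (col T)" by (auto simp: hole_def)
    then show "V \<in> (\<lambda>(Y, X). Brick Y X) ` (Pow (row T) \<times> Pow (col T))"
      by (rule rev_image_eqI) simp
  qed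
  show "finite ((\<lambda>(Y, X). Brick Y X) ` (Pow (row T) \<times> Pow (col T)))"
    using assms by simp
qed

lemma ex_maximum_hole:
  assumes "finite (row T)" "finite (col T)" "hole E T W"
  shows "\<exists>V. maximum_hole E T V"
proof -
  let ?S = "vcount ` {V. hole E T V}"
  have "finite ?S" using finite_holes[OF assms(1,2)] by simp
  moreover have "?S \<noteq> {}" using assms(3) by auto
  ultimately have "Max ?S \<in> ?S" "\<And>n. n \<in> ?S \<Longrightarrow> n \<le> Max ?S" by auto
  then show ?thesis unfolding maximum_hole_def by fastforce
qed

lemma excessive_if_solid:
  assumes "finite (row T)" "finite (col T)" "row T \<noteq> {}" "solid E T"
  shows "excessive E T"
proof -
  \<comment> \<open>\<open>characteristic\<close> measures the columns only if they outnumber the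
    rows strictly; in the balanced case both sides agree, so the longer side is taken in every
    case.\<close>
  have char: "characteristic E T = int (long T) - int (alpha_p E T)"
    by (auto simp: characteristic_def long_def horizontal_def)
  have "alpha_p E T < long T"
  proof (cases "\<exists>V. hole E T V")
    case True
    then have "Max (vcount ` {V. hole E T V}) < long T"
      using finite_holes[OF assms(1,2)] assms(4)
      by (subst Max_less_iff) (auto simp: solid_def not_le)
    then show ?thesis using True by (simp add: alpha_p_def)
  next
    case False
    have "card (row T) > 0" using assms by (simp add: card_gt_0_iff)
    then show ?thesis using False by (simp add: alpha_p_def long_def)
  qed
  then show ?thesis using char by (simp add: excessive_def m_excessive_def)
qed

lemma hole_condition_if_solid: "solid E T \<Longrightarrow> hole_condition E T"
  by (auto simp: solid_def hole_condition_def)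

section \<open>Components of a solid brick\<close>

text \<open>No vertex is isolated inside the brick, so each component has a row and a column and is
  itself a brick. The order of the vertices in the second conjunct makes the formula literally
  symmetric under \<open>transpose\<close>.\<close>

definition internally_joined :: "'a set set \<Rightarrow> 'a brick \<Rightarrow> bool" where
  "internally_joined E T \<longleftrightarrow>
     (\<forall>x\<in>col T. \<exists>y\<in>row T. {x, y} \<in> E) \<and> (\<forall>y\<in>row T. \<exists>x\<in>col T. {y, x} \<in> E)"

lemma internally_joined_transpose: "internally_joined E (transpose T) \<longleftrightarrow> internally_joined E T"
  by (auto simp: internally_joined_def)

lemma component_nonempty:
  assumes "internally_joined E T" "S \<in> component_bricks E T"
  shows "row S \<noteq> {}" "col S \<noteq> {}"
proof -
  obtain K: "verts S \<in> verts T // connection E (verts T)"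
    and rc: "row S = row T \<inter> verts S" "col S = col T \<inter> verts S"
    using assms(2) by (rule component_bricksE)
  note cp = component_props[OF K]
  obtain v where v: "v \<in> verts S" using cp(2) by blast
  have "v \<in> col T \<or> v \<in> row T" using v cp(1) by (auto simp: verts_def)
  then obtain x y where "x \<in> col T" "y \<in> row T" "{x, y} \<in> E" "v = x \<or> v = y"
    using assms(1) unfolding internally_joined_def by (metis insert_commute)
  moreover from this have "x \<in> verts S" "y \<in> verts S"
    using v cp(4)[of x y] cp(4)[of y x] by (auto simp: verts_def insert_commute[of y x])
  ultimately show "row S \<noteq> {}" "col S \<noteq> {}" using rc by auto
qed

lemma component_proper:
  assumes "internally_joined E T" "S \<in> component_bricks E T" "S \<noteq> T"
  shows "row S \<subset> row T" "col S \<subset> col T"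
proof -
  obtain K: "verts S \<in> verts T // connection E (verts T)"
    and rc: "row S = row T \<inter> verts S" "col S = col T \<inter> verts S"
    using assms(2) by (rule component_bricksE)
  note cp = component_props[OF K]
  have "verts S \<noteq> verts T" using rc assms(3) brick_Int_verts by (metis brick.collapse)
  then obtain v where v: "v \<in> verts T" "v \<notin> verts S" using cp(1) by blast
  have "v \<in> col T \<or> v \<in> row T" using v by (auto simp: verts_def)
  then obtain x y where "x \<in> col T" "y \<in> row T" "{x, y} \<in> E" "v = x \<or> v = y"
    using assms(1) unfolding internally_joined_def by (metis insert_commute)
  moreover from this have "x \<notin> verts S" "y \<notin> verts S"
    using v cp(4)[of x y] cp(4)[of y x] by (auto simp: verts_def insert_commute[of y x])
  ultimately show "row S \<subset> row T" "col S \<subset> col T" using rc by auto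
qed

text \<open>Columns of the other components have no neighbour among the rows of \<open>S\<close>, so
  all of them can be added to an independent pair inside \<open>S\<close>. \<open>X\<close> may be
  empty; the column of \<open>S\<close> left out keeps the result proper.\<close>

lemma component_hole:
  assumes "internally_joined E T" "S \<in> component_bricks E T" "S \<noteq> T" "row T \<inter> col T = {}"
    and "Y \<noteq> {}" "Y \<subseteq> row S" "X \<subseteq> col S" "\<And>x y. x \<in> X \<Longrightarrow> y \<in> Y \<Longrightarrow> {x, y} \<notin> E" "X \<noteq> col S"
  shows "hole E T (Brick Y (X \<union> (col T - col S)))"
proof -
  obtain K: "verts S \<in> verts T // connection E (verts T)"
    and rc: "row S = row T \<inter> verts S" "col S = col T \<inter> verts S"
    using assms(2) by (rule component_bricksE)
  note cp = component_props[OF K]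
  note pr = component_proper[OF assms(1-3)]
  have outside: "{x, y} \<notin> E" if "x \<in> col T - col S" "y \<in> Y" for x y
  proof
    assume "{x, y} \<in> E"
    then have "{y, x} \<in> E" by (simp add: insert_commute)
    moreover have "y \<in> verts S" "x \<in> verts T" using that assms(6) by (auto simp: verts_def)
    ultimately have "x \<in> verts S" using cp(4) by blast
    then show False using that rc by auto
  qed
  show ?thesis
    unfolding hole_def brick.sel
  proof (intro conjI ballI)
    show "Y \<subset> row T" using assms(6) pr(1) by (rule subset_psubset_trans)
    show "X \<union> (col T - col S) \<noteq> {}" using pr(2) by blast
    show "X \<union> (col T - col S) \<subset> col T" using pr(2) assms(7,9) by blast
    show "{x, y} \<notin> E" if "x \<in> X \<union> (col T - col S)" "y \<in> Y" for x y
      using that outside assms(8) by blast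
  qed (use assms(5) in simp)
qed

text \<open>An independent pair of \<open>S\<close> together with the columns outside
  \<open>S\<close> is a hole of \<open>T\<close>, of vcount below \<open>card (col T)\<close>;
  subtracting those columns leaves a total below \<open>card (col S)\<close>. All rows of
  \<open>S\<close> with no column give the shape, the holes of \<open>S\<close> give
  solidity.\<close>

lemma horizontal_component:
  assumes "internally_joined E T" "S \<in> component_bricks E T" "finite (row T)" "finite (col T)"
    "row T \<inter> col T = {}" "solid E T" "card (row T) \<le> card (col T)" "S \<noteq> T"
  shows "card (row S) < card (col S)" "solid E S"
proof -
  note ne = component_nonempty[OF assms(1,2)]
  note pr = component_proper[OF assms(1,2,8)]
  have long: "long T = card (col T)" using assms(7) by (simp add: long_def)
  have fin: "finite (col S)" "finite (row S)" using pr assms finite_subset by auto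
  have less: "card Y + card X < card (col S)"
    if "Y \<noteq> {}" "Y \<subseteq> row S" "X \<subseteq> col S" "\<And>x y. x \<in> X \<Longrightarrow> y \<in> Y \<Longrightarrow> {x, y} \<notin> E" "X \<noteq> col S" for Y X
  proof -
    have "hole E T (Brick Y (X \<union> (col T - col S)))"
      using component_hole[OF assms(1,2,8,5)] that by blast
    then have "card (X \<union> (col T - col S)) + card Y < card (col T)"
      using assms(6) long by (auto simp: solid_def vcount_def not_le)
    moreover have "card (X \<union> (col T - col S)) = card X + card (col T - col S)"
      using that(3) fin assms(4) by (intro card_Un_disjoint) (auto intro: finite_subset)
    moreover have "card (col T - col S) = card (col T) - card (col S)"
      using fin pr by (intro card_Diff_subset) auto
    moreover have "card (col S) \<le> card (col T)" using pr assms(4) by (intro card_mono) auto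
    ultimately show ?thesis by linarith
  qed
  show "card (row S) < card (col S)" using less[of "row S" "{}"] ne by auto
  show "solid E S"
    unfolding solid_def
  proof (intro notI, elim exE conjE)
    fix V assume V: "hole E S V" "long S \<le> vcount V"
    then have "vcount V < card (col S)"
      using less[of "row V" "col V"] unfolding hole_def vcount_def
      by (metis add.commute psubset_imp_subset psubset_eq)
    then show False using V by (simp add: long_def)
  qed
qed

text \<open>\<open>horizontal_component\<close> admits equal sides, so both it and its transpose
  apply to a balanced brick: a proper component would have fewer rows than columns and fewer columns
  than rows. An unbalanced brick hands its orientation to each component.\<close>

lemma component_of_solid:
  assumes "internally_joined E T" "S \<in> component_bricks E T" "finite (row T)" "finite (col T)"
    "row T \<inter> col T = {}" "solid E T"
  shows "solid E S" "balanced T \<Longrightarrow> S = T" "\<not> balanced T \<Longrightarrow> \<not> balanced S"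
proof -
  have t: "internally_joined E (transpose T)" "transpose S \<in> component_bricks E (transpose T)"
    "solid E (transpose T)" "row (transpose T) \<inter> col (transpose T) = {}"
    using assms by (auto simp: internally_joined_transpose component_bricks_transpose solid_transpose)
  have h: "card (row S) < card (col S) \<and> solid E S"
    if "card (row T) \<le> card (col T)" "S \<noteq> T"
    using horizontal_component[OF assms that] by simp
  have v: "card (col S) < card (row S) \<and> solid E S"
    if "card (col T) \<le> card (row T)" "S \<noteq> T"
    using horizontal_component[OF t(1,2) _ _ t(4,3)] that assms(3,4)
    by (metis solid_transpose transpose_simps(1,2,3))
  show "solid E S" using h v assms(6) by (metis linear)
  show "balanced T \<Longrightarrow> S = T" using h v by (metis balanced_def less_asym order_refl)
  show "\<not> balanced T \<Longrightarrow> \<not> balanced S" using h v by (metis balanced_def less_irrefl linear)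
qed

lemma connected_if_balanced_solid:
  assumes "internally_joined E T" "finite (row T)" "finite (col T)"
    "row T \<inter> col T = {}" "solid E T" "balanced T" "verts T \<noteq> {}"
  shows "connected_on E (verts T)"
proof -
  obtain S where "S \<in> component_bricks E T" using assms(7) component_bricks_cover by fast
  moreover from this have "S = T" using component_of_solid(2) assms by blast
  ultimately show ?thesis using component_bricksE component_props(3) by metis
qed
section \<open>Closed sets and maximum matchings\<close>

text \<open>Choosing a cover vertex on each edge is injective because matching edges are disjoint.
  At equality this choice is onto, so every cover vertex is matched and no edge uses up two of
  them.\<close>

lemma vertex_cover_bound:
  assumes "matching E M" "finite C" "\<And>e. e \<in> M \<Longrightarrow> e \<inter> C \<noteq> {}"
  shows "card M \<le> card C"
    and "card M = card C \<Longrightarrow> C \<subseteq> \<Union>M"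
    and "card M = card C \<Longrightarrow> e \<in> M \<Longrightarrow> u \<in> e \<inter> C \<Longrightarrow> v \<in> e \<inter> C \<Longrightarrow> u = v"
proof -
  have "\<forall>e\<in>M. \<exists>u. u \<in> e \<inter> C" using assms(3) by blast
  then obtain c where c: "\<And>e. e \<in> M \<Longrightarrow> c e \<in> e \<inter> C" by metis
  have share: "e = f" if "e \<in> M" "f \<in> M" "u \<in> e" "u \<in> f" for e f u
  proof (rule ccontr)
    assume "e \<noteq> f"
    then have "e \<inter> f = {}" using assms(1) that(1,2) by (simp add: matching_def)
    then show False using that(3,4) by blast
  qed
  have inj: "inj_on c M"
  proof (rule inj_onI)
    show "e = f" if "e \<in> M" "f \<in> M" "c e = c f" for e f
      using share[of e f "c e"] c[of e] c[of f] that by simp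
  qed
  have sub: "c ` M \<subseteq> C" using c by auto
  show "card M \<le> card C" using inj sub assms(2) by (rule card_inj_on_le)
  assume "card M = card C"
  then have onto: "c ` M = C" using card_subset_eq[OF assms(2) sub] card_image[OF inj] by simp
  then show "C \<subseteq> \<Union>M" using c by blast
  have only: "u = c e" if "e \<in> M" "u \<in> e \<inter> C" for u e
  proof -
    have "u \<in> c ` M" using onto that(2) by simp
    then obtain f where "f \<in> M" "u = c f" by blast
    then show ?thesis using c[of f] share[of e f u] that by simp
  qed
  show "u = v" if "e \<in> M" "u \<in> e \<inter> C" "v \<in> e \<inter> C" using only[of e u] only[of e v] that by simp
qed

text \<open>The reverse count: if no edge meets \<open>S\<close> twice, different saturated vertices
  have different edges. It serves to certify a minimum cover and to bound the matching inside a
  block from below.\<close>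

lemma card_saturated_le:
  assumes "finite M" "S \<subseteq> \<Union>M" "\<And>e u v. e \<in> M \<Longrightarrow> u \<in> e \<inter> S \<Longrightarrow> v \<in> e \<inter> S \<Longrightarrow> u = v"
  shows "card S \<le> card M"
proof -
  have "\<forall>u\<in>S. \<exists>e. e \<in> M \<and> u \<in> e" using assms(2) by blast
  then obtain h where h: "\<And>u. u \<in> S \<Longrightarrow> h u \<in> M \<and> u \<in> h u" by metis
  have "inj_on h S" 
  proof (rule inj_onI)
    show "u = v" if "u \<in> S" "v \<in> S" "h u = h v" for u v
      using assms(3)[of "h u" u v] h[of u] h[of v] that by simp
  qed
  moreover have "h ` S \<subseteq> M" using h by auto
  ultimately show ?thesis using assms(1) card_inj_on_le by blast
qed

lemma matchingD: "matching E M \<Longrightarrow> e \<in> M \<Longrightarrow> e \<in> E"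
  by (auto simp: matching_def)

locale bipartition =
  fixes A B :: "'a set" and E :: "'a set set"
  assumes bipartite: "bipartite_graph A B E"
begin

lemma fin_A [simp]: "finite A" and fin_B [simp]: "finite B" and disj: "A \<inter> B = {}"
  using bipartite by (auto simp: bipartite_graph_def)

lemma edgeE:
  assumes "e \<in> E"
  obtains x y where "x \<in> A" "y \<in> B" "e = {x, y}"
  using assms bipartite by (auto simp: bipartite_graph_def)

lemma edge_ends: "{u, v} \<in> E \<Longrightarrow> u \<in> A \<and> v \<in> B \<or> u \<in> B \<and> v \<in> A"
  by (erule edgeE) (auto simp: doubleton_eq_iff)

lemma edge_A: "{x, y} \<in> E \<Longrightarrow> x \<in> A \<Longrightarrow> y \<in> B"
  using edge_ends[of x y] disj by auto

lemma finite_E: "finite E"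
proof (rule finite_subset)
  show "E \<subseteq> Pow (A \<union> B)" by (auto elim: edgeE)
qed simp

text \<open>The axioms treat both colour classes alike. This second instance supplies the column
  versions of row statements and the region \<open>E\<close>.\<close>

lemma flip: "bipartition B A E"
proof -
  have "E \<subseteq> {{y, x} | y x. y \<in> B \<and> x \<in> A}"
  proof
    fix e assume "e \<in> E"
    then obtain x y where "x \<in> A" "y \<in> B" "e = {x, y}" by (rule edgeE)
    moreover from this have "e = {y, x}" by (simp add: insert_commute)
    ultimately show "e \<in> {{y, x} | y x. y \<in> B \<and> x \<in> A}" by blast
  qed
  then show ?thesis using disj by (simp add: bipartition_def bipartite_graph_def Int_commute)
qed

text \<open>The property of an initial segment of a BTF: an edge leaves it only from one of its
  rows, that is, forwards.\<close>

definition closed :: "'a set \<Rightarrow> bool" where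
  "closed F \<longleftrightarrow> F \<subseteq> A \<union> B \<and> (\<forall>x\<in>A \<inter> F. \<forall>y. {x, y} \<in> E \<longrightarrow> y \<in> F)"

text \<open>It equals \<open>card A\<close> minus the size of
  \<open>(B \<inter> F) \<union> (A - F)\<close>, so closed sets of maximum gain are those with the
  smallest cover of this form.\<close>

definition gain :: "'a set \<Rightarrow> int" where
  "gain F = int (card (A \<inter> F)) - int (card (B \<inter> F))"

text \<open>
  The pair \<open>(B - F, A \<inter> F)\<close> is independent iff \<open>F\<close> is closed, and it has \<open>card B + gain F\<close>
  vertices. So the tight sets correspond to the maximum independent sets of the graph.
\<close>

definition tight :: "'a set \<Rightarrow> bool" where
  "tight F \<longleftrightarrow> closed F \<and> (\<forall>G. closed G \<longrightarrow> gain G \<le> gain F)"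

lemma closed_subset: "closed F \<Longrightarrow> F \<subseteq> A \<union> B"
  by (simp add: closed_def)

lemma closedD: "closed F \<Longrightarrow> x \<in> A \<Longrightarrow> x \<in> F \<Longrightarrow> {x, y} \<in> E \<Longrightarrow> y \<in> F"
  by (auto simp: closed_def)

lemma closed_Un: "closed F \<Longrightarrow> closed G \<Longrightarrow> closed (F \<union> G)"
  and closed_Int: "closed F \<Longrightarrow> closed G \<Longrightarrow> closed (F \<inter> G)"
  and closed_empty: "closed {}"
  by (auto simp: closed_def)

lemma closed_all: "closed (A \<union> B)"
  using edge_A by (auto simp: closed_def)

lemma tight_closed: "tight F \<Longrightarrow> closed F"
  by (simp add: tight_def)

lemma tight_subset: "tight F \<Longrightarrow> F \<subseteq> A \<union> B"
  using tight_closed closed_subset by blast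

lemma gain_Un_Int: "gain (F \<union> G) + gain (F \<inter> G) = gain F + gain G"
proof -
  have "card (C \<inter> F) + card (C \<inter> G) = card (C \<inter> (F \<union> G)) + card (C \<inter> (F \<inter> G))" if "finite C" for C
    using that card_Un_Int[of "C \<inter> F" "C \<inter> G"] by (simp add: Int_Un_distrib inf_left_commute Int_assoc)
  from this[of A] this[of B] show ?thesis by (simp add: gain_def)
qed

lemma gain_diff: "P \<subseteq> Q \<Longrightarrow> gain Q = gain P + gain (Q - P)"
  using gain_Un_Int[of P "Q - P"] by (simp add: gain_def Un_absorb1)

text \<open>Uncrossing: by modularity the gains of union and intersection add up to twice the
  maximum, and neither exceeds it.\<close>

lemma tight_Un: "tight F \<Longrightarrow> tight G \<Longrightarrow> tight (F \<union> G)"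
  and tight_Int: "tight F \<Longrightarrow> tight G \<Longrightarrow> tight (F \<inter> G)"
proof -
  assume a: "tight F" "tight G"
  then have "gain (F \<union> G) \<le> gain F" "gain (F \<inter> G) \<le> gain F" "gain F = gain G"
    using closed_Un closed_Int by (auto simp: tight_def intro: antisym)
  then have "gain (F \<union> G) = gain F" "gain (F \<inter> G) = gain F" using gain_Un_Int[of F G] by auto
  then show "tight (F \<union> G)" "tight (F \<inter> G)" using a closed_Un closed_Int by (auto simp: tight_def)
qed

lemma tight_if_gain_ge: "tight F \<Longrightarrow> closed G \<Longrightarrow> gain F \<le> gain G \<Longrightarrow> tight G"
  by (auto simp: tight_def)

lemma ex_tight: "\<exists>F. tight F"
proof -
  have "finite {F. closed F}"
    by (rule finite_subset[of _ "Pow (A \<union> B)"]) (auto simp: closed_def)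
  then have fin: "finite (gain ` {F. closed F})" by simp
  have "gain {} \<in> gain ` {F. closed F}" using closed_empty by simp
  then have "Max (gain ` {F. closed F}) \<in> gain ` {F. closed F}" using fin Max_in by blast
  then obtain F where F: "closed F" "gain F = Max (gain ` {F. closed F})" by auto
  have "gain G \<le> gain F" if "closed G" for G
    unfolding F(2) using fin that by (intro Max_ge) auto
  then show ?thesis using F(1) unfolding tight_def by blast
qed

section \<open>Exchange of the colour classes\<close>

lemma flip_closed:
  assumes "closed F"
  shows "bipartition.closed B A E (A \<union> B - F)"
  unfolding bipartition.closed_def[OF flip]
proof (intro conjI ballI allI impI)
  fix y x assume y: "y \<in> B \<inter> (A \<union> B - F)" and e: "{y, x} \<in> E"
  then have "x \<in> A" using edge_ends[of y x] disj by auto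
  moreover have "x \<notin> F" using closedD[OF assms \<open>x \<in> A\<close>, of y] y e insert_commute[of x y "{}"] by auto
  ultimately show "x \<in> A \<union> B - F" by simp
qed auto

lemma flip_gain:
  assumes "F \<subseteq> A \<union> B"
  shows "bipartition.gain B A (A \<union> B - F) = gain F + int (card B) - int (card A)"
proof -
  have c: "int (card (C \<inter> (A \<union> B - F))) = int (card C) - int (card (C \<inter> F))"
    if "finite C" "C \<subseteq> A \<union> B" for C
  proof -
    have "C \<inter> (A \<union> B - F) = C - C \<inter> F" using that by auto
    moreover have "card (C \<inter> F) \<le> card C" using that by (intro card_mono) auto
    ultimately show ?thesis using that by (simp add: card_Diff_subset)
  qed
  show ?thesis using c[of A] c[of B] by (simp add: bipartition.gain_def[OF flip] gain_def)
qed

lemma flip_tight: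
  assumes "tight F"
  shows "bipartition.tight B A E (A \<union> B - F)"
proof -
  interpret f: bipartition B A E by (rule flip)
  have "f.gain G \<le> f.gain (A \<union> B - F)" if "f.closed G" for G
  proof -
    have G: "G \<subseteq> A \<union> B" using that f.closed_subset by blast
    have "closed (A \<union> B - G)" using f.flip_closed[OF that] by (simp add: Un_commute)
    then have "gain (A \<union> B - G) \<le> gain F" using assms by (simp add: tight_def)
    moreover have "gain (A \<union> B - G) = f.gain G + int (card A) - int (card B)"
      using f.flip_gain[of G] G by (simp add: Un_commute)
    ultimately show ?thesis using flip_gain[OF tight_subset[OF assms]] by simp
  qed
  then show ?thesis using flip_closed[OF tight_closed[OF assms]] by (simp add: f.tight_def)
qed

section \<open>Maximum matchings and the covers of tight sets\<close>

lemma tight_rows_matchable: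
  assumes "tight F"
  shows "\<exists>f. inj_on f (B \<inter> F) \<and> (\<forall>y\<in>B \<inter> F. f y \<in> A \<inter> F \<and> {f y, y} \<in> E)"
proof -
  have "\<exists>f. inj_on f (B \<inter> F) \<and> (\<forall>y\<in>B \<inter> F. f y \<in> {x \<in> A \<inter> F. {x, y} \<in> E})"
  proof (rule hall)
    fix J assume J: "J \<subseteq> B \<inter> F"
    let ?N = "\<Union>y\<in>J. {x \<in> A \<inter> F. {x, y} \<in> E}"
    \<comment> \<open>Deleting from \<open>F\<close> some rows and all their neighbours inside
      \<open>F\<close> leaves a closed set. It cannot beat the gain of \<open>F\<close>, and this
      comparison is Hall's condition for \<open>J\<close>.\<close>
    let ?G = "F - J - ?N"
    have FAB: "F \<subseteq> A \<union> B" by (rule tight_subset[OF assms])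
    have "closed ?G"
      unfolding closed_def
    proof (intro conjI ballI allI impI)
      fix x y assume x: "x \<in> A \<inter> ?G" and e: "{x, y} \<in> E"
      have "y \<in> F" using x e closedD[OF tight_closed[OF assms]] by blast
      moreover have "y \<in> B" using e x edge_A by blast
      ultimately show "y \<in> ?G" using x e disj by auto
    qed (use FAB in auto)
    then have "gain ?G \<le> gain F" using assms by (simp add: tight_def)
    moreover have "A \<inter> ?G = A \<inter> F - ?N" "B \<inter> ?G = B \<inter> F - J" using J disj by auto
    moreover have "card (A \<inter> F - ?N) = card (A \<inter> F) - card ?N" "card ?N \<le> card (A \<inter> F)"
      by (auto intro!: card_Diff_subset card_mono intro: finite_subset[of _ A])
    moreover have "card (B \<inter> F - J) = card (B \<inter> F) - card J" "card J \<le> card (B \<inter> F)"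
      using J by (auto intro!: card_Diff_subset card_mono intro: finite_subset[of _ B])
    ultimately show "card J \<le> card ?N" by (simp add: gain_def)
  qed auto
  then show ?thesis by auto
qed

lemma ex_matching_of_tight:
  assumes "tight F"
  shows "\<exists>M. matching E M \<and> card M = card (B \<inter> F) + card (A - F)"
proof -
  interpret f: bipartition B A E by (rule flip)
  obtain f where f: "inj_on f (B \<inter> F)" "\<And>y. y \<in> B \<inter> F \<Longrightarrow> f y \<in> A \<inter> F \<and> {f y, y} \<in> E"
    using tight_rows_matchable[OF assms] by blast
  \<comment> \<open>For the exchanged classes the rows are \<open>A\<close> and the tight set is the
    complement of \<open>F\<close>, so the columns outside \<open>F\<close> get partners outside
    \<open>F\<close>. The two partial matchings lie on different sides of \<open>F\<close> and
    cannot meet.\<close>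
  have eq: "A \<inter> (A \<union> B - F) = A - F" by auto
  obtain g where g: "inj_on g (A - F)" "\<And>x. x \<in> A - F \<Longrightarrow> g x \<in> B - F \<and> {g x, x} \<in> E"
    using f.tight_rows_matchable[OF flip_tight[OF assms]] unfolding eq by blast
  let ?R = "(\<lambda>y. {f y, y}) ` (B \<inter> F)" and ?S = "(\<lambda>x. {g x, x}) ` (A - F)"
  have inj: "inj_on (\<lambda>y. {f y, y}) (B \<inter> F)" "inj_on (\<lambda>x. {g x, x}) (A - F)"
  proof (rule inj_onI)
    show "y = z" if "y \<in> B \<inter> F" "z \<in> B \<inter> F" "{f y, y} = {f z, z}" for y z
      using that f(2)[of y] f(2)[of z] disj by (auto simp: doubleton_eq_iff)
    show "inj_on (\<lambda>x. {g x, x}) (A - F)"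
    proof (rule inj_onI)
      show "y = z" if "y \<in> A - F" "z \<in> A - F" "{g y, y} = {g z, z}" for y z
        using that g(2)[of y] g(2)[of z] disj by (auto simp: doubleton_eq_iff)
    qed
  qed
  have "e \<inter> e' = {}" if "e \<in> ?R \<union> ?S" "e' \<in> ?R \<union> ?S" "e \<noteq> e'" for e e'
  proof -
    have RR: "{f y, y} \<inter> {f z, z} = {}" if "y \<in> B \<inter> F" "z \<in> B \<inter> F" "y \<noteq> z" for y z
      using that f(2)[of y] f(2)[of z] disj inj_onD[OF f(1), of y z] by auto
    have SS: "{g y, y} \<inter> {g z, z} = {}" if "y \<in> A - F" "z \<in> A - F" "y \<noteq> z" for y z
      using that g(2)[of y] g(2)[of z] disj inj_onD[OF g(1), of y z] by auto
    have RS: "{f y, y} \<inter> {g z, z} = {}" if "y \<in> B \<inter> F" "z \<in> A - F" for y z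
      using that f(2)[of y] g(2)[of z] by auto
    from that(1,2) show ?thesis
    proof (elim UnE imageE)
      fix y z assume "e = {f y, y}" "y \<in> B \<inter> F" "e' = {f z, z}" "z \<in> B \<inter> F"
      then show ?thesis using RR[of y z] that(3) by metis
    next
      fix y z assume "e = {f y, y}" "y \<in> B \<inter> F" "e' = {g z, z}" "z \<in> A - F"
      then show ?thesis using RS[of y z] by metis
    next
      fix y z assume "e = {g z, z}" "z \<in> A - F" "e' = {f y, y}" "y \<in> B \<inter> F"
      then show ?thesis using RS[of y z] by (metis Int_commute)
    next
      fix y z assume "e = {g y, y}" "y \<in> A - F" "e' = {g z, z}" "z \<in> A - F"
      then show ?thesis using SS[of y z] that(3) by metis
    qed
  qed
  moreover have "?R \<union> ?S \<subseteq> E" using f(2) g(2) by auto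
  ultimately have "matching E (?R \<union> ?S)" unfolding matching_def by blast
  moreover have "{f y, y} \<noteq> {g z, z}" if "y \<in> B \<inter> F" "z \<in> A - F" for y z
    using that f(2)[of y] g(2)[of z] by (auto simp: doubleton_eq_iff)
  then have "?R \<inter> ?S = {}" by blast
  then have "card (?R \<union> ?S) = card (B \<inter> F) + card (A - F)"
    using inj by (subst card_Un_disjoint) (auto simp: card_image)
  ultimately show ?thesis by blast
qed

lemma cover_of_closed:
  assumes "closed F" "e \<in> E"
  shows "e \<inter> ((B \<inter> F) \<union> (A - F)) \<noteq> {}"
proof -
  obtain x y where "x \<in> A" "y \<in> B" "e = {x, y}" using assms(2) by (rule edgeE)
  then show ?thesis using closedD[OF assms(1), of x y] assms(2) by auto
qed

lemma card_cover: "card ((B \<inter> F) \<union> (A - F)) = card (B \<inter> F) + card (A - F)"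
  using disj by (intro card_Un_disjoint) auto

lemma matching_card_le:
  assumes "matching E M" "closed F"
  shows "card M \<le> card (B \<inter> F) + card (A - F)"
proof -
  have "e \<inter> ((B \<inter> F) \<union> (A - F)) \<noteq> {}" if "e \<in> M" for e
    using cover_of_closed[OF assms(2)] matchingD[OF assms(1) that] by blast
  then show ?thesis
    using vertex_cover_bound(1)[OF assms(1), of "(B \<inter> F) \<union> (A - F)"] by (simp add: card_cover)
qed

lemma maximum_matching_card:
  assumes "maximum_matching E M" "tight F"
  shows "card M = card (B \<inter> F) + card (A - F)"
proof (rule antisym)
  show "card M \<le> card (B \<inter> F) + card (A - F)"
    using assms(1) matching_card_le[OF _ tight_closed[OF assms(2)]] by (simp add: maximum_matching_def)
  obtain N where "matching E N" "card N = card (B \<inter> F) + card (A - F)"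
    using ex_matching_of_tight[OF assms(2)] by blast
  then show "card (B \<inter> F) + card (A - F) \<le> card M"
    using assms(1) unfolding maximum_matching_def by metis
qed

lemma ex_maximum_matching: "\<exists>M. maximum_matching E M"
proof -
  obtain F where F: "tight F" using ex_tight by blast
  obtain M where M: "matching E M" "card M = card (B \<inter> F) + card (A - F)"
    using ex_matching_of_tight[OF F] by blast
  have "card N \<le> card M" if "matching E N" for N
    using matching_card_le[OF that tight_closed[OF F]] M(2) by simp
  then show ?thesis using M(1) unfolding maximum_matching_def by blast
qed

lemma matching_share: "matching E M \<Longrightarrow> {u, v} \<in> M \<Longrightarrow> {u, w} \<in> M \<Longrightarrow> v = w"
proof (rule ccontr)
  assume m: "matching E M" "{u, v} \<in> M" "{u, w} \<in> M" and "v \<noteq> w"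
  then have ne: "{u, v} \<noteq> {u, w}" by (auto simp: doubleton_eq_iff)
  have "e \<inter> f = {}" if "e \<in> M" "f \<in> M" "e \<noteq> f" for e f
    using m(1) that by (simp add: matching_def)
  from this[OF m(2,3) ne] have "{u, v} \<inter> {u, w} = {}" .
  then show False by blast
qed

text \<open>Equality in the cover bound. By closedness an edge across \<open>F\<close> joins a
  column outside to a row inside, so both its ends lie in the cover, and equality excludes this for
  edges of \<open>M\<close>.\<close>

lemma
  assumes "maximum_matching E M" "tight F"
  shows maximum_matching_saturates: "(B \<inter> F) \<union> (A - F) \<subseteq> \<Union>M"
    and maximum_matching_no_cross: "e \<in> M \<Longrightarrow> e \<subseteq> F \<or> e \<inter> F = {}"
proof -
  let ?C = "(B \<inter> F) \<union> (A - F)"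
  have m: "matching E M" using assms(1) by (simp add: maximum_matching_def)
  have ne: "\<And>e. e \<in> M \<Longrightarrow> e \<inter> ?C \<noteq> {}"
    using cover_of_closed[OF tight_closed[OF assms(2)]] matchingD[OF m] by blast
  have c: "card M = card ?C" using maximum_matching_card[OF assms] card_cover by simp
  have fin: "finite ?C" by simp
  show "?C \<subseteq> \<Union>M" using vertex_cover_bound(2)[OF m fin ne c] .
  show "e \<subseteq> F \<or> e \<inter> F = {}" if e: "e \<in> M"
  proof -
    obtain x y where xy: "x \<in> A" "y \<in> B" "e = {x, y}" using matchingD[OF m e] by (rule edgeE)
    have "x \<noteq> y" using xy disj by blast
    then have "\<not> (x \<notin> F \<and> y \<in> F)"
      using vertex_cover_bound(3)[OF m fin ne c e, of x y] xy by auto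
    moreover have "x \<in> F \<Longrightarrow> y \<in> F"
      using closedD[OF tight_closed[OF assms(2)], of x y] xy matchingD[OF m e] by simp
    ultimately show ?thesis using xy by auto
  qed
qed

section \<open>Alternating paths\<close>

lemma alternating_path_parity:
  assumes "matching E M" "alternating_path E M p" "hd p \<in> A - \<Union>M" "i < length p"
  shows "if even i then p ! i \<in> A \<and> (i > 0 \<longrightarrow> {p ! (i - 1), p ! i} \<in> M)
     else p ! i \<in> B \<and> {p ! (i - 1), p ! i} \<notin> M"
  using assms(4)
proof (induction i)
  case 0
  then show ?case using assms(3) by (simp add: hd_conv_nth)
next
  case (Suc i)
  have edge: "{p ! i, p ! Suc i} \<in> E" using assms(2) Suc.prems by (auto simp: alternating_path_def)
  show ?case
  proof (cases i)
    case 0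
    \<comment> \<open>The alternation condition relates consecutive edges only; the phase is fixed
      here, since the first vertex is unmatched and its edge is not in \<open>M\<close>.\<close>
    then have "p ! 0 \<in> A - \<Union>M" using assms(2,3) by (simp add: hd_conv_nth alternating_path_def)
    then show ?thesis using 0 edge edge_A by auto
  next
    case (Suc k)
    then have "{p ! k, p ! i} \<in> M \<longleftrightarrow> {p ! i, p ! Suc i} \<notin> M"
      using assms(2) Suc.prems unfolding alternating_path_def by (metis Suc_eq_plus1 add_2_eq_Suc')
    then show ?thesis
      using Suc.IH Suc.prems Suc edge edge_A[of "p ! i"] edge_ends[of "p ! i" "p ! Suc i"] disj by (auto split: if_splits)
  qed
qed

lemma reach_prefix:
  assumes "alternating_path E M p" "hd p \<in> S - \<Union>M" "w \<in> set p"
  shows "w \<in> alternating_reach E M S"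
proof -
  obtain j where j: "j < length p" "w = p ! j" using assms(3) by (auto simp: in_set_conv_nth)
  have "alternating_path E M (take (Suc j) p)"
    using assms(1) j by (auto simp: alternating_path_def)
  moreover have "hd (take (Suc j) p) = hd p" using j by (cases p) auto
  moreover have "last (take (Suc j) p) = w" using j by (simp add: take_Suc_conv_app_nth)
  ultimately show ?thesis using assms(2) unfolding alternating_reach_def by auto
qed

text \<open>Paths have distinct vertices, so only a new vertex can be appended; an old one is
  reached by a prefix. The alternation premise is conditional because a single vertex has no last
  edge.\<close>

lemma reach_extend:
  assumes "alternating_path E M p" "hd p \<in> S - \<Union>M" "{last p, w} \<in> E"
    "length p \<ge> 2 \<Longrightarrow> {p ! (length p - 2), last p} \<in> M \<longleftrightarrow> {last p, w} \<notin> M"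
  shows "w \<in> alternating_reach E M S"
proof (cases "w \<in> set p")
  case True
  then show ?thesis using reach_prefix assms by blast
next
  case False
  have p: "p \<noteq> []" using assms(1) by (simp add: alternating_path_def)
  have last: "last p = p ! (length p - 1)" using p by (rule last_conv_nth)
  have "alternating_path E M (p @ [w])"
    unfolding alternating_path_def
  proof (intro conjI allI impI)
    show "distinct (p @ [w])" using assms(1) False by (simp add: alternating_path_def)
    fix i
    show "{(p @ [w]) ! i, (p @ [w]) ! (i + 1)} \<in> E" if "i + 1 < length (p @ [w])"
    proof (cases "i + 1 < length p")
      case True
      then show ?thesis using assms(1) by (simp add: alternating_path_def nth_append)
    next
      case False
      then have "i = length p - 1" "i < length p" using that p by (auto simp: less_Suc_eq)
      then show ?thesis using assms(3) last p by (simp add: nth_append)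
    qed
    show "{(p @ [w]) ! i, (p @ [w]) ! (i + 1)} \<in> M \<longleftrightarrow>
        {(p @ [w]) ! (i + 1), (p @ [w]) ! (i + 2)} \<notin> M" if "i + 2 < length (p @ [w])"
    proof (cases "i + 2 < length p")
      case True
      then show ?thesis using assms(1) by (simp add: alternating_path_def nth_append)
    next
      case False
      then have i: "i + 2 = length p" using that by auto
      then have "i = length p - 2" "i + 1 = length p - 1" "length p \<ge> 2" by auto
      then show ?thesis using assms(4) last i by (simp add: nth_append)
    qed
  qed simp
  moreover have "hd (p @ [w]) = hd p" using p by simp
  moreover have "last (p @ [w]) = w" by simp
  ultimately show ?thesis
    unfolding alternating_reach_def using assms(2) by (intro CollectI exI[of _ "p @ [w]"]) simp
qed

lemma reachE:
  assumes "v \<in> alternating_reach E M S"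
  obtains p where "alternating_path E M p" "hd p \<in> S - \<Union>M" "last p = v"
    "length p > 0" "v = p ! (length p - 1)"
  using assms that unfolding alternating_reach_def alternating_path_def
  by (auto simp: last_conv_nth)

text \<open>An unmatched column lies in \<open>F\<close>, since the columns outside are saturated.
  Edges followed from a column stay in \<open>F\<close> by closedness; a row is left along a
  matching edge, and those do not cross \<open>F\<close>.\<close>

lemma reach_subset_tight:
  assumes "maximum_matching E M" "tight F"
  shows "alternating_reach E M A \<subseteq> F"
proof
  fix v assume "v \<in> alternating_reach E M A"
  then obtain p where p: "alternating_path E M p" "hd p \<in> A - \<Union>M"
    "length p > 0" "v = p ! (length p - 1)" by (rule reachE)
  have m: "matching E M" using assms(1) by (simp add: maximum_matching_def)
  note par = alternating_path_parity[OF m p(1,2)]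
  have "p ! i \<in> F" if "i < length p" for i
    using that
  proof (induction i)
    case 0
    then show ?case using p(2,3) maximum_matching_saturates[OF assms] by (auto simp: hd_conv_nth)
  next
    case (Suc i)
    have edge: "{p ! i, p ! Suc i} \<in> E" using p(1) Suc.prems by (auto simp: alternating_path_def)
    show ?case
    proof (cases "even i")
      case True
      then show ?thesis using par[of i] Suc edge closedD[OF tight_closed[OF assms(2)]] by auto
    next
      case False
      then have "{p ! i, p ! Suc i} \<in> M" using par[of "Suc i"] Suc by auto
      then show ?thesis using Suc maximum_matching_no_cross[OF assms] by fastforce
    qed
  qed
  then show "v \<in> F" using p by simp
qed

lemma reach_closed_A:
  assumes "matching E M" "x \<in> A" "x \<in> alternating_reach E M A" "{x, y} \<in> E"
  shows "y \<in> alternating_reach E M A"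
proof -
  obtain p where p: "alternating_path E M p" "hd p \<in> A - \<Union>M" "last p = x"
    "length p > 0" "x = p ! (length p - 1)" using assms(3) by (rule reachE)
  note par = alternating_path_parity[OF assms(1) p(1,2), of "length p - 1"]
  show ?thesis
  proof (cases "y \<in> set p")
    case True
    then show ?thesis using reach_prefix p by blast
  next
    case False
    show ?thesis
    proof (rule reach_extend[OF p(1,2)])
      show "{last p, y} \<in> E" using p assms by simp
      assume l: "length p \<ge> 2"
      \<comment> \<open>\<open>x\<close> is a column other than the start, so it was entered along
        its matching edge; its partner is on the path and differs from \<open>y\<close>.\<close>
      have "even (length p - 1)" using par p assms(2) disj by (auto split: if_splits)
      moreover have "length p - 1 - 1 = length p - 2" by simp
      ultimately have "{p ! (length p - 2), x} \<in> M" using par p l by (auto split: if_splits)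
      moreover have "p ! (length p - 2) \<in> set p" using l by auto
      ultimately have "{x, y} \<notin> M"
        using matching_share[OF assms(1), of x y "p ! (length p - 2)"] False by (auto simp: insert_commute)
      then show "{p ! (length p - 2), last p} \<in> M \<longleftrightarrow> {last p, y} \<notin> M"
        using \<open>{p ! (length p - 2), x} \<in> M\<close> p by simp
    qed
  qed
qed

lemma reach_partner:
  assumes "matching E M" "y \<in> B" "y \<in> alternating_reach E M A" "{y, x} \<in> M"
  shows "x \<in> alternating_reach E M A"
proof -
  obtain p where p: "alternating_path E M p" "hd p \<in> A - \<Union>M" "last p = y"
    "length p > 0" "y = p ! (length p - 1)" using assms(3) by (rule reachE)
  note par = alternating_path_parity[OF assms(1) p(1,2), of "length p - 1"]
  have "{p ! (length p - 1 - 1), y} \<notin> M" using par p assms(2) disj by (auto split: if_splits)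
  then have "{p ! (length p - 2), y} \<notin> M" by (simp add: numeral_2_eq_2)
  then show ?thesis
    using reach_extend[OF p(1,2), of x] p assms(4) matchingD[OF assms(1,4)] by simp
qed

text \<open>Tightness is certified by counting: \<open>M\<close> saturates the cover belonging to
  the reached set and meets it once per edge, so this cover is no larger than that of a tight set.
  That reached rows are matched is the absence of augmenting paths; here it comes from the inclusion
  in a tight set.\<close>

lemma reach_tight:
  assumes "maximum_matching E M"
  shows "tight (alternating_reach E M A)"
proof -
  let ?R = "alternating_reach E M A"
  obtain F where F: "tight F" using ex_tight by blast
  have RF: "?R \<subseteq> F" using reach_subset_tight[OF assms F] .
  have m: "matching E M" using assms by (simp add: maximum_matching_def)
  have cl: "closed ?R"
    unfolding closed_def using RF tight_subset[OF F] reach_closed_A[OF m] by blast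
  have "B \<inter> ?R \<subseteq> \<Union>M" using maximum_matching_saturates[OF assms F] RF by blast
  moreover have "A - ?R \<subseteq> \<Union>M"
  proof
    fix x assume x: "x \<in> A - ?R"
    have "x \<in> ?R" if "x \<in> A - \<Union>M"
      unfolding alternating_reach_def using that
      by (auto intro!: exI[of _ "[x]"] simp: alternating_path_def)
    then show "x \<in> \<Union>M" using x by blast
  qed
  moreover have "u = v" if e: "e \<in> M" "u \<in> e \<inter> ((B \<inter> ?R) \<union> (A - ?R))" "v \<in> e \<inter> ((B \<inter> ?R) \<union> (A - ?R))" for e u v
  proof -
    obtain x y where xy: "x \<in> A" "y \<in> B" "e = {x, y}" using matchingD[OF m e(1)] by (rule edgeE)
    have "y \<in> ?R \<Longrightarrow> x \<in> ?R" using reach_partner[OF m, of y x] xy e(1) by (simp add: insert_commute)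
    moreover have "x \<notin> B" "y \<notin> A" using xy disj by auto
    ultimately show ?thesis using e(2,3) xy(3) by (cases "y \<in> ?R") auto
  qed
  ultimately have "card ((B \<inter> ?R) \<union> (A - ?R)) \<le> card M"
    using finite_subset[OF _ finite_E] matchingD[OF m] by (intro card_saturated_le) blast+
  then have le: "card (B \<inter> ?R) + card (A - ?R) \<le> card (B \<inter> F) + card (A - F)"
    using maximum_matching_card[OF assms F] card_cover by simp
  have "card (A \<inter> G) + card (A - G) = card A" for G by (rule card_Int_Diff[symmetric]) simp
  from this[of ?R] this[of F] le have "gain F \<le> gain ?R" by (simp add: gain_def)
  then show ?thesis using tight_if_gain_ge F cl by blast
qed

end
section \<open>Cuts and the excessive decomposition\<close>

locale bipartition_full = bipartition +
  assumes no_isolated: "v \<in> A \<union> B \<Longrightarrow> \<exists>e\<in>E. v \<in> e"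
begin

text \<open>The two trivial cuts are the ends of every chain of cuts; they need not be tight.\<close>

definition cut :: "'a set \<Rightarrow> bool" where
  "cut F \<longleftrightarrow> F = {} \<or> F = A \<union> B \<or> tight F"

definition brick_of :: "'a set \<Rightarrow> 'a brick" where
  "brick_of W = Brick (B \<inter> W) (A \<inter> W)"

text \<open>The covering relation in the lattice of cuts.\<close>

definition elementary :: "'a set \<Rightarrow> 'a set \<Rightarrow> bool" where
  "elementary P Q \<longleftrightarrow> cut P \<and> cut Q \<and> P \<subset> Q \<and>
     (\<forall>F. cut F \<longrightarrow> P \<subseteq> F \<longrightarrow> F \<subseteq> Q \<longrightarrow> F = P \<or> F = Q)"

lemma cut_closed: "cut F \<Longrightarrow> closed F"
  using closed_empty closed_all tight_closed by (auto simp: cut_def)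

lemma cut_subset: "cut F \<Longrightarrow> F \<subseteq> A \<union> B"
  using cut_closed closed_subset by blast

lemma cut_Un: "cut F \<Longrightarrow> cut G \<Longrightarrow> cut (F \<union> G)"
  and cut_Int: "cut F \<Longrightarrow> cut G \<Longrightarrow> cut (F \<inter> G)"
proof -
  assume a: "cut F" "cut G"
  then have s: "F \<subseteq> A \<union> B" "G \<subseteq> A \<union> B" using cut_subset by auto
  have triv: "cut {}" "cut (A \<union> B)" by (simp_all add: cut_def)
  show "cut (F \<union> G)"
  proof (cases "tight F \<and> tight G")
    case True then show ?thesis using tight_Un by (simp add: cut_def)
  next
    case False
    then have "F = {} \<or> G = {} \<or> F = A \<union> B \<or> G = A \<union> B" using a by (auto simp: cut_def)
    then show ?thesis
      using a triv Un_absorb1[OF s(1)] Un_absorb2[OF s(2)] by (elim disjE) simp_all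
  qed
  show "cut (F \<inter> G)"
  proof (cases "tight F \<and> tight G")
    case True then show ?thesis using tight_Int by (simp add: cut_def)
  next
    case False
    then have "F = {} \<or> G = {} \<or> F = A \<union> B \<or> G = A \<union> B" using a by (auto simp: cut_def)
    then show ?thesis
      using a triv Int_absorb2[OF s(1)] Int_absorb1[OF s(2)] by (elim disjE) simp_all
  qed
qed

lemma brick_of_simps [simp]: "row (brick_of W) = B \<inter> W" "col (brick_of W) = A \<inter> W"
  by (simp_all add: brick_of_def)

lemma verts_brick_of: "W \<subseteq> A \<union> B \<Longrightarrow> verts (brick_of W) = W"
  by (auto simp: verts_def)

lemma verts_block: "cut Q \<Longrightarrow> verts (brick_of (Q - P)) = Q - P"
  using cut_subset by (intro verts_brick_of) blast

lemma neighbour: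
  assumes "v \<in> A \<union> B"
  obtains w where "{v, w} \<in> E"
proof -
  obtain e where e: "e \<in> E" "v \<in> e" using no_isolated[OF assms] by blast
  obtain x y where xy: "e = {x, y}" using e(1) by (rule edgeE)
  then have "v = x \<or> v = y" using e(2) by simp
  then show ?thesis using e(1) xy that[of x] that[of y] insert_commute[of x y "{}"] by metis
qed

lemma gain_insert:
  assumes "x \<in> A" "x \<notin> F"
  shows "gain (insert x F) = gain F + 1"
proof -
  have "A \<inter> insert x F = insert x (A \<inter> F)" "B \<inter> insert x F = B \<inter> F" using assms disj by auto
  then show ?thesis using assms by (simp add: gain_def)
qed

lemma gain_remove:
  assumes "y \<in> B" "y \<in> F"
  shows "gain (F - {y}) = gain F + 1"
proof -
  have "B \<inter> (F - {y}) = B \<inter> F - {y}" "A \<inter> (F - {y}) = A \<inter> F" using assms disj by auto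
  moreover have "card (B \<inter> F) = Suc (card (B \<inter> F - {y}))" using assms by (intro card.remove) auto
  ultimately show ?thesis by (simp add: gain_def)
qed

text \<open>A column with no neighbour inside could be added to \<open>P\<close>, and a row with
  none could be dropped from \<open>Q\<close>; the new set would be closed with gain larger by one.
  The neighbour that the vertex has in the graph shows that the cut in question is not trivial,
  hence tight.\<close>

lemma neighbour_within_block:
  assumes "cut P" "cut Q" "v \<in> Q - P"
  shows "\<exists>u\<in>Q - P. {v, u} \<in> E"
proof (rule ccontr)
  assume "\<not> ?thesis"
  then have none: "\<And>u. {v, u} \<in> E \<Longrightarrow> u \<in> Q \<Longrightarrow> u \<in> P" by blast
  have v: "v \<in> A \<union> B" using assms cut_subset by blast
  obtain w where w: "{v, w} \<in> E" using v by (rule neighbour)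
  show False
  proof (cases "v \<in> A")
    case True
    have nb: "u \<in> P" if "{v, u} \<in> E" for u
      using none[OF that] closedD[OF cut_closed[OF assms(2)] True _ that] assms(3) by blast
    then have "tight P" using w assms(1,3) v unfolding cut_def by blast
    moreover have "closed (insert v P)"
      unfolding closed_def using nb v cut_closed[OF assms(1)] by (auto simp: closed_def)
    ultimately have "gain (insert v P) \<le> gain P" by (simp add: tight_def)
    then show False using gain_insert[OF True] assms(3) by simp
  next
    case False
    then have vB: "v \<in> B" using v by simp
    have nb: "u \<in> A - Q" if "{v, u} \<in> E" for u
    proof -
      have u: "u \<in> A" using that vB edge_ends[of v u] disj by blast
      have "{u, v} \<in> E" using that by (simp add: insert_commute)
      then have "u \<notin> P" using closedD[OF cut_closed[OF assms(1)] u, of v] assms(3) by blast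
      then show ?thesis using none[OF that] u by blast
    qed
    then have "tight Q" using w assms(2,3) v unfolding cut_def by blast
    moreover have "closed (Q - {v})"
      unfolding closed_def
    proof (intro conjI ballI allI impI)
      show "Q - {v} \<subseteq> A \<union> B" using cut_subset[OF assms(2)] by blast
      fix x y assume x: "x \<in> A \<inter> (Q - {v})" and e: "{x, y} \<in> E"
      have "y \<in> Q" using closedD[OF cut_closed[OF assms(2)] _ _ e] x by blast
      moreover have "y \<noteq> v" using nb[of x] x e by (auto simp: insert_commute[of x v])
      ultimately show "y \<in> Q - {v}" by blast
    qed
    ultimately have "gain (Q - {v}) \<le> gain Q" by (simp add: tight_def)
    then show False using gain_remove[OF vB] assms(3) by simp
  qed
qed

lemma internally_joined_block:
  assumes "cut P" "cut Q"
  shows "internally_joined E (brick_of (Q - P))"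
  unfolding internally_joined_def
proof (intro conjI ballI)
  show "\<exists>y\<in>row (brick_of (Q - P)). {x, y} \<in> E" if "x \<in> col (brick_of (Q - P))" for x
    using neighbour_within_block[OF assms, of x] that edge_A[of x] by auto
  show "\<exists>x\<in>col (brick_of (Q - P)). {y, x} \<in> E" if "y \<in> row (brick_of (Q - P))" for y
    using neighbour_within_block[OF assms, of y] that edge_ends[of y] disj by force
qed

lemma block_nonempty:
  assumes "cut P" "cut Q" "P \<subset> Q"
  shows "A \<inter> (Q - P) \<noteq> {}" "B \<inter> (Q - P) \<noteq> {}"
proof -
  obtain v where v: "v \<in> Q - P" using assms by blast
  then obtain u where u: "u \<in> Q - P" "{v, u} \<in> E" using neighbour_within_block assms by blast
  then show "A \<inter> (Q - P) \<noteq> {}" "B \<inter> (Q - P) \<noteq> {}" using edge_ends[of v u] v by auto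
qed

lemma card_split:
  assumes "P \<subseteq> F" "F \<subseteq> Q" "finite C"
  shows "card (C \<inter> (Q - P)) = card (C \<inter> (F - P)) + card (C \<inter> (Q - F))"
proof -
  have "C \<inter> (Q - P) = C \<inter> (F - P) \<union> C \<inter> (Q - F)" using assms by auto
  moreover have "(C \<inter> (F - P)) \<inter> (C \<inter> (Q - F)) = {}" by auto
  ultimately show ?thesis using assms(3) by (simp add: card_Un_disjoint)
qed

text \<open>Neither end has more gain than the tight set \<open>F\<close>, so \<open>F - P\<close>
  has at least as many columns as rows and \<open>Q - F\<close> at least as many rows as columns.
  Hence the columns before \<open>F\<close> and the rows after it together reach both side
  lengths.\<close>

lemma hole_of_cut:
  assumes "cut P" "cut Q" "cut F" "P \<subset> F" "F \<subset> Q"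
  shows "\<exists>V. hole E (brick_of (Q - P)) V \<and> long (brick_of (Q - P)) \<le> vcount V"
proof -
  have "tight F" using assms cut_subset[OF assms(2)] unfolding cut_def by blast
  then have "gain P \<le> gain F" "gain Q \<le> gain F"
    using cut_closed assms(1,2) by (auto simp: tight_def)
  moreover have "gain F = gain P + gain (F - P)" "gain Q = gain F + gain (Q - F)"
    using assms by (auto intro: gain_diff)
  ultimately have g: "card (B \<inter> (F - P)) \<le> card (A \<inter> (F - P))" "card (A \<inter> (Q - F)) \<le> card (B \<inter> (Q - F))"
    by (simp_all add: gain_def)
  let ?V = "Brick (B \<inter> (Q - F)) (A \<inter> (F - P))"
  have "{x, y} \<notin> E" if "x \<in> A \<inter> (F - P)" "y \<in> B \<inter> (Q - F)" for x y
    using that closedD[OF cut_closed[OF assms(3)], of x y] by blast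
  moreover have "B \<inter> (Q - F) \<noteq> {}" "A \<inter> (F - P) \<noteq> {}" "A \<inter> (Q - F) \<noteq> {}" "B \<inter> (F - P) \<noteq> {}"
    using block_nonempty assms by auto
  ultimately have "hole E (brick_of (Q - P)) ?V"
    using assms(4,5) by (auto simp: hole_def)
  moreover have "long (brick_of (Q - P)) \<le> vcount ?V"
    using g card_split[of P F Q A] card_split[of P F Q B] assms by (simp add: long_def vcount_def)
  ultimately show ?thesis by blast
qed

text \<open>
  A maximum hole of a block between cuts is a new tight set, except that between the two
  trivial cuts its maximality first has to be compared with the independent sets which are no holes.
\<close>

lemma split_at_hole:
  fixes P Q :: "'a set" and V :: "'a brick"
  defines "T \<equiv> brick_of (Q - P)" and "F \<equiv> P \<union> (B \<inter> (Q - P) - row V) \<union> col V"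
  assumes "cut P" "cut Q" "P \<subset> Q" "maximum_hole E T V" "long T \<le> vcount V"
  shows "tight F" "P \<subset> F" "F \<subset> Q"
    "Brick (row T - row V) (col V) = brick_of (F - P)"
    "Brick (row V) (col T - col V) = brick_of (Q - F)"
proof -
  have V: "row V \<noteq> {}" "row V \<subset> B \<inter> (Q - P)" "col V \<noteq> {}" "col V \<subset> A \<inter> (Q - P)"
    and Vfree: "\<And>x y. x \<in> col V \<Longrightarrow> y \<in> row V \<Longrightarrow> {x, y} \<notin> E"
    using assms(6) by (auto simp: maximum_hole_def hole_def T_def)
  have QAB: "Q \<subseteq> A \<union> B" using cut_subset[OF assms(4)] .
  show sub: "P \<subset> F" "F \<subset> Q" using V assms(5) disj by (auto simp: F_def)
  have parts: "B \<inter> (F - P) = B \<inter> (Q - P) - row V" "A \<inter> (F - P) = col V"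
    "B \<inter> (Q - F) = row V" "A \<inter> (Q - F) = A \<inter> (Q - P) - col V"
    using V disj by (auto simp: F_def)
  show "Brick (row T - row V) (col V) = brick_of (F - P)"
    "Brick (row V) (col T - col V) = brick_of (Q - F)"
    unfolding brick_of_def parts by (simp_all add: T_def)
  have closed: "closed F"
    unfolding closed_def
  proof (intro conjI ballI allI impI)
    show "F \<subseteq> A \<union> B" using sub QAB by blast
    fix x y assume x: "x \<in> A \<inter> F" and e: "{x, y} \<in> E"
    have y: "y \<in> B" using edge_A[OF e] x by blast
    show "y \<in> F"
    proof (cases "x \<in> P")
      case True
      then show ?thesis using closedD[OF cut_closed[OF assms(3)], of x y] x e by (auto simp: F_def)
    next
      case False
      then have xV: "x \<in> col V" using x disj by (auto simp: F_def)
      then have "y \<in> Q" using closedD[OF cut_closed[OF assms(4)], of x y] V(4) e by blast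
      moreover have "y \<notin> row V" using Vfree[OF xV] e by blast
      ultimately show ?thesis using y by (auto simp: F_def)
    qed
  qed
  have v: "vcount V = card (A \<inter> (F - P)) + card (B \<inter> (Q - F))" unfolding parts vcount_def ..
  have long: "card (A \<inter> (Q - P)) \<le> vcount V" "card (B \<inter> (Q - P)) \<le> vcount V"
    using assms(7) by (simp_all add: long_def T_def)
  have split: "card (C \<inter> (Q - P)) = card (C \<inter> (F - P)) + card (C \<inter> (Q - F))" if "finite C" for C
    using sub that by (intro card_split) auto
  have "gain F = gain P + gain (F - P)" "gain Q = gain F + gain (Q - F)"
    using sub by (auto intro: gain_diff)
  then have gP: "gain P \<le> gain F" and gQ: "gain Q \<le> gain F"
    using long split[OF fin_A] split[OF fin_B] v by (simp_all add: gain_def)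
  show "tight F"
  proof (cases "tight P \<or> tight Q")
    case True
    then show ?thesis using tight_if_gain_ge gP gQ closed by blast
  next
    case False
    then have PQ: "P = {}" "Q = A \<union> B" using assms(3-5) QAB unfolding cut_def by auto
    have "gain G \<le> gain F" if G: "closed G" for G
    proof (cases "hole E T (Brick (B - G) (A \<inter> G))")
      case True
      then have "vcount (Brick (B - G) (A \<inter> G)) \<le> vcount V"
        using assms(6) by (auto simp: maximum_hole_def)
      then have "card (A \<inter> G) + card (B - G) \<le> card (A \<inter> F) + card (B - F)"
        using v PQ sub(2) by (auto simp: vcount_def Diff_eq Int_Un_distrib inf_commute inf_left_commute disj)
      moreover have "card (B \<inter> H) + card (B - H) = card B" for H
        by (rule card_Int_Diff[symmetric]) simp
      from this[of F] this[of G] have "card (B \<inter> F) + card (B - F) = card (B \<inter> G) + card (B - G)" by simp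
      ultimately show ?thesis by (simp add: gain_def)
    next
      case False
      \<comment> \<open>A closed set that gives no hole is degenerate: without isolated vertices it
        has no columns or all rows. Its gain is then at most that of a trivial cut, which
        \<open>F\<close> reaches because the vcount of the hole is at least both side
        lengths.\<close>
      have free: "\<forall>x\<in>A \<inter> G. \<forall>y\<in>B - G. {x, y} \<notin> E" using closedD[OF G] by blast
      have nb: "B \<inter> G \<noteq> {}" if ne: "A \<inter> G \<noteq> {}"
      proof -
        obtain x where x: "x \<in> A \<inter> G" using ne by blast
        then obtain w where "{x, w} \<in> E" using neighbour[of x] by blast
        then show ?thesis using x closedD[OF G, of x w] edge_A[of x w] by blast
      qed
      have all: "B \<subseteq> G" if "A \<subseteq> G"
      proof
        fix y assume y: "y \<in> B"
        then obtain w where w: "{y, w} \<in> E" using neighbour[of y] by blast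
        then have "w \<in> A" using y edge_ends[of y w] disj by blast
        then show "y \<in> G" using that w closedD[OF G, of w y] by (auto simp: insert_commute[of y w])
      qed
      have "A \<inter> G = {} \<or> B - G = {}"
        using False free nb all unfolding hole_def T_def PQ by auto
      then show ?thesis
      proof
        assume "A \<inter> G = {}"
        then have "gain G \<le> gain {}" by (simp add: gain_def)
        then show ?thesis using gP PQ by simp
      next
        assume "B - G = {}"
        then have "B \<inter> G = B" "card (A \<inter> G) \<le> card A" by (auto intro: card_mono)
        then have "gain G \<le> gain (A \<union> B)" by (simp add: gain_def Int_Un_distrib Int_absorb2 Int_Un_eq)
        then show ?thesis using gQ PQ by simp
      qed
    qed
    then show ?thesis using closed by (simp add: tight_def)
  qed
qed

section \<open>Maximal chains of cuts, recorded by the bricks of their steps\<close>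

primrec chain :: "'a set \<Rightarrow> 'a brick list \<Rightarrow> 'a set \<Rightarrow> bool" where
  "chain P [] Q \<longleftrightarrow> P = Q"
| "chain P (T # L) Q \<longleftrightarrow> (\<exists>F. elementary P F \<and> T = brick_of (F - P) \<and> chain F L Q)"

lemma chain_append: "chain P L F \<Longrightarrow> chain F L' Q \<Longrightarrow> chain P (L @ L') Q"
  by (induction L arbitrary: P) auto

lemma chain_subset: "chain P L Q \<Longrightarrow> P \<subseteq> Q"
  by (induction L arbitrary: P) (auto simp: elementary_def)

lemma elementary_if_solid:
  assumes "cut P" "cut Q" "P \<subset> Q" "solid E (brick_of (Q - P))"
  shows "elementary P Q"
proof -
  have "F = P \<or> F = Q" if "cut F" "P \<subseteq> F" "F \<subseteq> Q" for F
    using hole_of_cut[OF assms(1,2) that(1)] that assms(4) unfolding solid_def by blast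
  then show ?thesis using assms(1-3) by (simp add: elementary_def)
qed

lemma solid_if_elementary:
  assumes "elementary P Q"
  shows "solid E (brick_of (Q - P))"
  unfolding solid_def
proof
  let ?T = "brick_of (Q - P)"
  assume "\<exists>V. hole E ?T V \<and> long ?T \<le> vcount V"
  then obtain W where W: "hole E ?T W" "long ?T \<le> vcount W" by blast
  \<comment> \<open>Between the trivial cuts a large hole need not give a tight set, but a maximum
    one does.\<close>
  then obtain V where V: "maximum_hole E ?T V" using ex_maximum_hole[of ?T E W] by auto
  then have "long ?T \<le> vcount V" using W unfolding maximum_hole_def by (meson le_trans)
  with V assms show False
    using split_at_hole[of P Q V] unfolding elementary_def cut_def by (metis psubset_eq)
qed

text \<open>A hole splits its block at a cut, so both recursive calls are again blocks between cuts;
  the induction therefore ranges over all pairs \<open>P\<close>, \<open>Q\<close>. A leaf is a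
  single elementary step because it is solid.\<close>

lemma decomposes_chain:
  assumes "decomposes E T L" "T = brick_of (Q - P)" "cut P" "cut Q" "P \<subset> Q"
  shows "chain P L Q"
  using assms
proof (induction arbitrary: P Q rule: decomposes.induct)
  case (block T)
  then have "elementary P Q" by (intro elementary_if_solid) (auto simp: solid_def)
  then show ?case using block by auto
next
  case (split T V L1 L2)
  let ?F = "P \<union> (B \<inter> (Q - P) - row V) \<union> col V"
  have V: "maximum_hole E (brick_of (Q - P)) V" using split by simp
  have "long (brick_of (Q - P)) \<le> vcount V"
    using split(1,2,7) unfolding maximum_hole_def by (meson le_trans)
  note F = split_at_hole[OF split.prems(2-4) V this]
  have "cut ?F" using F(1) by (simp add: cut_def)
  then have "chain P L1 ?F" "chain ?F L2 Q"
    using split.IH(1)[of ?F P] split.IH(2)[of Q ?F] F split.prems by simp_all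
  then show ?case by (rule chain_append)
qed

text \<open>The relation \<open>decomposes\<close> is inductive, so the existence of a run is a
  matter of termination: both parts of a split have fewer vertices.\<close>

lemma ex_decomposes:
  assumes "cut P" "cut Q" "P \<subset> Q"
  shows "\<exists>L. decomposes E (brick_of (Q - P)) L"
  using assms
proof (induction "card (Q - P)" arbitrary: P Q rule: less_induct)
  case less
  let ?T = "brick_of (Q - P)"
  show ?case
  proof (cases "\<exists>W. hole E ?T W \<and> vcount W \<ge> long ?T")
    case False
    then show ?thesis using decomposes.block by blast
  next
    case True
    then obtain W where W: "hole E ?T W" "long ?T \<le> vcount W" by blast
    then obtain V where V: "maximum_hole E ?T V" using ex_maximum_hole[of ?T E W] by auto
    then have "long ?T \<le> vcount V" using W unfolding maximum_hole_def by (meson le_trans)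
    note F = split_at_hole[OF less.prems V this]
    let ?F = "P \<union> (B \<inter> (Q - P) - row V) \<union> col V"
    have cF: "cut ?F" using F(1) by (simp add: cut_def)
    have fin: "finite (Q - P)" using cut_subset[OF less.prems(2)] by (auto intro: finite_subset)
    have "card (?F - P) < card (Q - P)" "card (Q - ?F) < card (Q - P)"
      using F(2,3) fin by (auto intro!: psubset_card_mono)
    then obtain L1 L2 where "decomposes E (brick_of (?F - P)) L1" "decomposes E (brick_of (Q - ?F)) L2"
      using less.hyps[of ?F P] less.hyps[of Q ?F] cF F(2,3) less.prems by blast
    then show ?thesis using decomposes.split[OF True V, of L1 L2] unfolding F(4,5) by blast
  qed
qed

lemma chain_members:
  assumes "chain P L Q" "T \<in> set L"
  obtains P' Q' where "elementary P' Q'" "T = brick_of (Q' - P')" "P \<subseteq> P'" "Q' \<subseteq> Q"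
  using assms
proof (induction L arbitrary: P thesis)
  case (Cons S L)
  obtain F where F: "elementary P F" "S = brick_of (F - P)" "chain F L Q" using Cons.prems(2) by auto
  show ?case
  proof (cases "T = S")
    case True
    then show ?thesis using Cons.prems(1)[OF F(1)] F chain_subset by blast
  next
    case False
    then obtain P' Q' where "elementary P' Q'" "T = brick_of (Q' - P')" "F \<subseteq> P'" "Q' \<subseteq> Q"
      using Cons.IH[of F] F(3) Cons.prems(3) by auto
    moreover have "P \<subseteq> F" using F(1) by (auto simp: elementary_def)
    ultimately show ?thesis using Cons.prems(1) by blast
  qed
qed simp

lemma chain_verts:
  assumes "chain P L Q"
  shows "(\<Union>T\<in>set L. verts T) = Q - P"
  using assms
proof (induction L arbitrary: P)
  case (Cons S L)
  then obtain F where F: "elementary P F" "S = brick_of (F - P)" "chain F L Q" by auto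
  then have "verts S = F - P" "P \<subseteq> F" using verts_block by (auto simp: elementary_def)
  then show ?case using Cons.IH[OF F(3)] chain_subset[OF F(3)] by auto
qed simp

text \<open>Any cut \<open>F\<close> can be pushed into the interval as
  \<open>(F \<inter> Q) \<union> P\<close>, where it has to be one of the ends, so \<open>F\<close>
  contains all or nothing of the step. Other vertices are separated from the step by
  \<open>P\<close> or \<open>Q\<close>.\<close>

lemma elementary_class:
  assumes "elementary P Q" "v \<in> Q - P"
  shows "{u \<in> A \<union> B. \<forall>F. cut F \<longrightarrow> (u \<in> F \<longleftrightarrow> v \<in> F)} = Q - P"
proof (intro equalityI subsetI)
  have PQ: "cut P" "cut Q" "P \<subset> Q" using assms(1) by (auto simp: elementary_def)
  show "u \<in> Q - P" if "u \<in> {u \<in> A \<union> B. \<forall>F. cut F \<longrightarrow> (u \<in> F \<longleftrightarrow> v \<in> F)}" for u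
    using that PQ assms(2) by blast
  fix u assume u: "u \<in> Q - P"
  have "u \<in> F \<longleftrightarrow> v \<in> F" if "cut F" for F
  proof -
    have "cut ((F \<inter> Q) \<union> P)" using that PQ cut_Un cut_Int by blast
    then have "(F \<inter> Q) \<union> P = P \<or> (F \<inter> Q) \<union> P = Q" using assms(1) unfolding elementary_def by blast
    then show ?thesis using u assms(2) by blast
  qed
  then show "u \<in> {u \<in> A \<union> B. \<forall>F. cut F \<longrightarrow> (u \<in> F \<longleftrightarrow> v \<in> F)}" using u cut_subset[OF PQ(2)] by blast
qed

text \<open>The right-hand side does not mention \<open>L\<close>: this is the independence of the
  choice of maximum holes.\<close>

lemma chain_set:
  assumes "chain {} L (A \<union> B)"
  shows "set L = (\<lambda>v. brick_of {u \<in> A \<union> B. \<forall>F. cut F \<longrightarrow> (u \<in> F \<longleftrightarrow> v \<in> F)}) ` (A \<union> B)"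
proof (intro equalityI subsetI)
  fix T assume "T \<in> set L"
  then obtain P Q where PQ: "elementary P Q" "T = brick_of (Q - P)"
    using chain_members[OF assms] by metis
  then obtain v where v: "v \<in> Q - P" by (auto simp: elementary_def)
  moreover have "v \<in> A \<union> B" using v PQ(1) cut_subset by (auto simp: elementary_def)
  ultimately show "T \<in> (\<lambda>v. brick_of {u \<in> A \<union> B. \<forall>F. cut F \<longrightarrow> (u \<in> F \<longleftrightarrow> v \<in> F)}) ` (A \<union> B)"
    using elementary_class[OF PQ(1) v] PQ(2) by (intro image_eqI[of _ _ v]) simp_all
next
  fix T assume "T \<in> (\<lambda>v. brick_of {u \<in> A \<union> B. \<forall>F. cut F \<longrightarrow> (u \<in> F \<longleftrightarrow> v \<in> F)}) ` (A \<union> B)"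
  then obtain v where v: "v \<in> A \<union> B"
    and T: "T = brick_of {u \<in> A \<union> B. \<forall>F. cut F \<longrightarrow> (u \<in> F \<longleftrightarrow> v \<in> F)}" by blast
  have "v \<in> (\<Union>T\<in>set L. verts T)" using chain_verts[OF assms] v by simp
  then obtain S where S: "S \<in> set L" "v \<in> verts S" by blast
  obtain P Q where PQ: "elementary P Q" "S = brick_of (Q - P)"
    using chain_members[OF assms S(1)] by metis
  then have "v \<in> Q - P" using S(2) verts_block by (simp add: elementary_def)
  then show "T \<in> set L" using elementary_class[OF PQ(1)] T PQ(2) S(1) by simp
qed

end
section \<open>Block triangular forms\<close>

definition precedes :: "'a set set \<Rightarrow> 'a brick \<Rightarrow> 'a brick \<Rightarrow> bool" where
  "precedes E S T \<longleftrightarrow> verts S \<inter> verts T = {} \<and> \<not> (\<exists>y\<in>row T. \<exists>x\<in>col S. {x, y} \<in> E)"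

lemma btf_iff:
  "btf A B E L \<longleftrightarrow> (\<forall>T\<in>set L. is_brick A B T) \<and> (\<Union>T\<in>set L. verts T) = A \<union> B \<and>
     sorted_wrt (precedes E) L"
  unfolding btf_def precedes_def ..

lemma precedes_components_of:
  assumes "precedes E S T" "S' \<in> component_bricks E S" "T' \<in> component_bricks E T"
  shows "precedes E S' T'"
proof -
  have "row R' \<subseteq> row R \<and> col R' \<subseteq> col R" if "R' \<in> component_bricks E R" for R R'
    using that by (auto simp: component_bricks_def)
  from this[OF assms(2)] this[OF assms(3)] show ?thesis
    using assms(1) unfolding precedes_def verts_def by blast
qed

text \<open>No edge joins two components, so both orders are allowed; this is why components may be
  listed arbitrarily.\<close>

lemma precedes_components:
  assumes "S \<in> component_bricks E T" "S' \<in> component_bricks E T" "S \<noteq> S'"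
  shows "precedes E S S'"
  unfolding precedes_def
proof (intro conjI notI)
  show disj: "verts S \<inter> verts S' = {}" using component_bricks_disjoint assms .
  obtain K: "verts S \<in> verts T // connection E (verts T)" using assms(1) by (rule component_bricksE)
  obtain K': "verts S' \<in> verts T // connection E (verts T)" using assms(2) by (rule component_bricksE)
  assume "\<exists>y\<in>row S'. \<exists>x\<in>col S. {x, y} \<in> E"
  then obtain x y where xy: "y \<in> row S'" "x \<in> col S" "{x, y} \<in> E" by blast
  then have "x \<in> verts S" "y \<in> verts S'" by (auto simp: verts_def)
  then have "y \<in> verts S" using component_props(4)[OF K _ _ xy(3)] component_props(1)[OF K'] by blast
  then show False using disj \<open>y \<in> verts S'\<close> by blast
qed

lemma sorted_components:
  assumes "distinct X" "set X \<subseteq> component_bricks E T"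
  shows "sorted_wrt (precedes E) X"
  using assms by (induction X) (auto intro: precedes_components)

context bipartition
begin

lemma joined_iff:
  assumes "is_brick A B S" "is_brick A B T" "precedes E S T"
  shows "joined E S T \<longleftrightarrow> (\<exists>y\<in>row S. \<exists>x\<in>col T. {x, y} \<in> E)"
proof
  assume "joined E S T"
  then obtain u v where uv: "u \<in> verts S" "v \<in> verts T" "{u, v} \<in> E" by (auto simp: joined_def)
  have vu: "{v, u} \<in> E" using uv(3) by (simp add: insert_commute)
  have "u \<in> B \<and> v \<in> A"
  proof (rule ccontr)
    assume "\<not> ?thesis"
    then have "u \<in> A" "v \<in> B" using edge_ends[OF uv(3)] by auto
    then have "u \<in> col S" "v \<in> row T"
      using uv(1,2) assms(1,2) disj by (auto simp: verts_def is_brick_def)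
    then show False using assms(3) uv(3) unfolding precedes_def by blast
  qed
  then have "u \<in> row S" "v \<in> col T"
    using uv(1,2) assms(1,2) disj by (auto simp: verts_def is_brick_def)
  then show "\<exists>y\<in>row S. \<exists>x\<in>col T. {x, y} \<in> E" using vu by blast
next
  assume "\<exists>y\<in>row S. \<exists>x\<in>col T. {x, y} \<in> E"
  then obtain x y where xy: "y \<in> row S" "x \<in> col T" "{x, y} \<in> E" by blast
  have "{y, x} \<in> E" using xy(3) by (simp add: insert_commute)
  then show "joined E S T" using xy(1,2) unfolding joined_def verts_def by blast
qed

lemma btf_nth:
  assumes "btf A B E L" "i < j" "j < length L"
  shows "precedes E (L ! i) (L ! j)" "joined E (L ! i) (L ! j) \<longleftrightarrow>
    (\<exists>y\<in>row (L ! i). \<exists>x\<in>col (L ! j). {x, y} \<in> E)"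
proof -
  show p: "precedes E (L ! i) (L ! j)" using assms by (auto simp: btf_iff sorted_wrt_iff_nth_less)
  show "joined E (L ! i) (L ! j) \<longleftrightarrow> (\<exists>y\<in>row (L ! i). \<exists>x\<in>col (L ! j). {x, y} \<in> E)"
    using assms p by (intro joined_iff) (auto simp: btf_iff)
qed

lemma btf_distinct:
  assumes "btf A B E L"
  shows "distinct L"
  unfolding distinct_conv_nth
proof (intro allI impI)
  have ne: "L ! i \<noteq> L ! j" if "i < j" "j < length L" for i j
  proof
    assume "L ! i = L ! j"
    then have "verts (L ! j) = {}" using btf_nth(1)[OF assms that] by (simp add: precedes_def)
    moreover have "is_brick A B (L ! j)" using assms that by (auto simp: btf_iff)
    ultimately show False by (simp add: is_brick_def verts_eq_empty_iff)
  qed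
  show "L ! i \<noteq> L ! j" if "i < length L" "j < length L" "i \<noteq> j" for i j
    using ne[of i j] ne[of j i] that by (metis nat_neq_iff)
qed

text \<open>Joined blocks cannot change places, since their edge would run backwards; along a
  sequence of joined blocks this adds up, so comparable blocks keep their order. Distinctness of the
  blocks makes the position map a bijection.\<close>

lemma btf_incomparable_permutation:
  assumes L: "btf A B E L" and L': "btf A B E L'" "set L' = set L"
  shows "incomparable_permutation E L L'"
proof -
  let ?n = "length L"
  have dist: "distinct L" "distinct L'" using btf_distinct L L'(1) by auto
  have len: "length L' = ?n" using distinct_card[OF dist(1)] distinct_card[OF dist(2)] L'(2) by simp
  have "\<exists>j<?n. L' ! j = L ! i" if "i < ?n" for i
    using nth_mem[OF that] unfolding L'(2)[symmetric] in_set_conv_nth len .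
  then obtain \<pi> where \<pi>: "\<And>i. i < ?n \<Longrightarrow> \<pi> i < ?n" "\<And>i. i < ?n \<Longrightarrow> L' ! \<pi> i = L ! i" by metis
  have inj: "inj_on \<pi> {..<?n}"
  proof (rule inj_onI)
    fix i j assume i: "i \<in> {..<?n}" and j: "j \<in> {..<?n}" and eq: "\<pi> i = \<pi> j"
    have "L ! i = L' ! \<pi> i" using \<pi>(2) i by simp
    also have "\<dots> = L ! j" unfolding eq using \<pi>(2) j by simp
    finally show "i = j" using nth_eq_iff_index_eq[OF dist(1)] i j by simp
  qed
  moreover have "\<pi> ` {..<?n} = {..<?n}"
    using inj \<pi>(1) by (intro endo_inj_surj) auto
  ultimately have bij: "bij_betw \<pi> {..<?n} {..<?n}" by (simp add: bij_betw_def)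
  have keep: "\<pi> i < \<pi> j" if ij: "i < j" "j < ?n" "joined E (L ! i) (L ! j)" for i j
  proof (rule ccontr)
    assume "\<not> ?thesis"
    moreover have "\<pi> i \<noteq> \<pi> j" using inj ij by (simp add: inj_on_eq_iff)
    ultimately have "\<pi> j < \<pi> i" by simp
    then have "precedes E (L ! j) (L ! i)"
      using btf_nth(1)[OF L'(1), of "\<pi> j" "\<pi> i"] \<pi>(1)[of i] \<pi>(2)[of i] \<pi>(2)[of j] ij len by simp
    then show False using btf_nth(2)[OF L ij(1,2)] ij(3) by (simp add: precedes_def)
  qed
  let ?R = "{(k, l). k < l \<and> l < ?n \<and> joined E (L ! k) (L ! l)}"
  have path: "i = j \<or> i < j \<and> \<pi> i < \<pi> j" if "(i, j) \<in> ?R\<^sup>*" for i j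
    using that
  proof (induction rule: rtrancl_induct)
    case (step k l)
    then show ?case using keep[of k l] by auto
  qed simp
  have "\<pi> i < \<pi> j" if ij: "i < j" "j < ?n" "comparable E L i j" for i j
  proof -
    have "(i, j) \<in> ?R\<^sup>* \<or> (j, i) \<in> ?R\<^sup>*" using ij(3) unfolding comparable_def Let_def .
    then show ?thesis using path[of i j] path[of j i] ij(1) by linarith
  qed
  then show ?thesis
    unfolding incomparable_permutation_def using len bij \<pi> by (intro conjI exI[of _ \<pi>]) simp_all
qed

lemma incomparable_permutation_btf:
  assumes L: "btf A B E L" and "incomparable_permutation E L L'"
  shows "btf A B E L'" "set L' = set L"
proof -
  let ?n = "length L"
  obtain \<pi> where len: "length L' = ?n" and bij: "bij_betw \<pi> {..<?n} {..<?n}"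
    and \<pi>: "\<And>i. i < ?n \<Longrightarrow> L' ! \<pi> i = L ! i"
    and mono: "\<And>i j. i < j \<Longrightarrow> j < ?n \<Longrightarrow> comparable E L i j \<Longrightarrow> \<pi> i < \<pi> j"
    using assms(2) unfolding incomparable_permutation_def by blast
  have inv: "\<exists>i<?n. a = \<pi> i" if "a < ?n" for a
    using bij that unfolding bij_betw_def by (metis imageE lessThan_iff)
  have "set L' = (\<lambda>k. L' ! k) ` {..<?n}" using len by (auto simp: set_conv_nth)
  also have "\<dots> = (\<lambda>k. L' ! k) ` \<pi> ` {..<?n}" using bij by (simp add: bij_betw_def)
  also have "\<dots> = (\<lambda>k. L ! k) ` {..<?n}" using \<pi> by (simp add: image_image)
  also have "\<dots> = set L" by (auto simp: set_conv_nth)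
  finally show set: "set L' = set L" .
  have "precedes E (L' ! a) (L' ! b)" if ab: "a < b" "b < ?n" for a b
  proof -
    obtain i j where ij: "i < ?n" "j < ?n" "a = \<pi> i" "b = \<pi> j" using inv[of a] inv[of b] ab by auto
    have "precedes E (L ! i) (L ! j)"
    proof (cases "i < j")
      case True
      then show ?thesis using btf_nth(1)[OF L] ij by simp
    next
      case False
      then have ji: "j < i" using ij ab by (metis linorder_neqE_nat nat_less_le)
      \<comment> \<open>Blocks in reversed order are incomparable, in particular not joined, and
        disjoint blocks without an edge precede each other both ways.\<close>
      have "\<not> joined E (L ! j) (L ! i)"
      proof
        assume "joined E (L ! j) (L ! i)"
        then have "comparable E L j i" 
          using ji ij(1) unfolding comparable_def Let_def by (intro disjI1 r_into_rtrancl) simp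
        then have "\<pi> j < \<pi> i" using mono ji ij(1) by blast
        then show False using ij ab by simp
      qed
      then show ?thesis
        using btf_nth[OF L ji ij(1)] by (auto simp: precedes_def)
    qed
    then show ?thesis using \<pi> ij by simp
  qed
  then show "btf A B E L'"
    using L set len by (simp add: btf_iff sorted_wrt_iff_nth_less)
qed

section \<open>The regions in terms of the least and the greatest tight set\<close>

lemma dm_D_eq:
  assumes "maximum_matching E M" "tight H" "\<forall>F. tight F \<longrightarrow> H \<subseteq> F"
  shows "dm_D A B E M = H"
  using reach_subset_tight[OF assms(1,2)] assms(3)[rule_format, OF reach_tight[OF assms(1)]]
  unfolding dm_D_def by (rule equalityI)

lemma dm_E_eq:
  assumes "maximum_matching E M" "tight G" "\<forall>F. tight F \<longrightarrow> F \<subseteq> G"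
  shows "dm_E A B E M = A \<union> B - G"
proof -
  interpret f: bipartition B A E by (rule flip)
  have R: "f.tight (alternating_reach E M B)" by (rule f.reach_tight[OF assms(1)])
  have "alternating_reach E M B \<subseteq> A \<union> B - G"
    by (rule f.reach_subset_tight[OF assms(1) flip_tight[OF assms(2)]])
  moreover have "B \<union> A - alternating_reach E M B \<subseteq> G"
    by (rule assms(3)[rule_format, OF f.flip_tight[OF R]])
  ultimately show ?thesis unfolding dm_E_def by blast
qed

end

context bipartition_full
begin

lemma chain_btf:
  assumes "chain P L Q"
  shows "sorted_wrt (precedes E) L"
  using assms
proof (induction L arbitrary: P)
  case (Cons T L)
  then obtain F where F: "elementary P F" "T = brick_of (F - P)" "chain F L Q" by auto
  have "precedes E T S" if ST: "S \<in> set L" for S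
  proof -
    obtain P' Q' where S: "elementary P' Q'" "S = brick_of (Q' - P')" "F \<subseteq> P'"
      using chain_members[OF F(3) ST] by metis
    have "verts T = F - P" "verts S = Q' - P'"
      using F(1,2) S(1,2) verts_block by (auto simp: elementary_def)
    moreover have "\<not> (\<exists>y\<in>row S. \<exists>x\<in>col T. {x, y} \<in> E)"
    proof
      assume "\<exists>y\<in>row S. \<exists>x\<in>col T. {x, y} \<in> E"
      then obtain x y where "y \<in> Q' - P'" "x \<in> A" "x \<in> F" "{x, y} \<in> E" using F(2) S(2) by auto
      moreover have "closed F" using F(1) cut_closed by (simp add: elementary_def)
      ultimately show False using closedD[of F x y] S(3) by blast
    qed
    ultimately show ?thesis using S(3) unfolding precedes_def by blast
  qed
  then show ?case using Cons.IH[OF F(3)] by simp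
qed simp

lemma is_brick_block: "elementary P Q \<Longrightarrow> is_brick A B (brick_of (Q - P))"
  using block_nonempty by (auto simp: is_brick_def elementary_def)

lemma chain_is_btf:
  assumes "chain {} L (A \<union> B)"
  shows "btf A B E L"
proof -
  have "is_brick A B T" if "T \<in> set L" for T
    using chain_members[OF assms that] is_brick_block by metis
  then show ?thesis using chain_verts[OF assms] chain_btf[OF assms] by (simp add: btf_iff)
qed

section \<open>The shape of a maximal chain\<close>

lemma elementary_tight:
  assumes "elementary P Q"
  shows "tight P \<or> tight Q"
proof (rule ccontr)
  assume n: "\<not> ?thesis"
  obtain F where F: "tight F" using ex_tight by blast
  \<comment> \<open>If neither end is tight, they are the two trivial cuts with no cut strictly
    between; but some tight set exists and would have to be one of them.\<close>
  have PQ: "P = {}" "Q = A \<union> B"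
    using assms n cut_subset[of Q] unfolding elementary_def cut_def by auto
  have "F = P \<or> F = Q"
    using assms F tight_subset[OF F] unfolding elementary_def PQ by (simp add: cut_def)
  then show False using n F by blast
qed

lemma gain_block:
  assumes "P \<subseteq> Q"
  shows "gain Q = gain P + int (card (col (brick_of (Q - P)))) - int (card (row (brick_of (Q - P))))"
  using gain_diff[OF assms] by (simp add: gain_def[of "Q - P"])

lemma tight_gain_eq: "tight P \<Longrightarrow> tight Q \<Longrightarrow> gain P = gain Q"
  by (auto simp: tight_def intro: antisym)

lemma tight_gain_less: "tight P \<Longrightarrow> closed Q \<Longrightarrow> \<not> tight Q \<Longrightarrow> gain Q < gain P"
  using tight_if_gain_ge[of P Q] by linarith

text \<open>Above a tight set every step to a further tight set keeps the gain and is balanced. The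
  only cut there that can fail to be tight is the whole vertex set, so at most the last step loses
  gain, and the last tight set reached is the greatest.\<close>

lemma chain_above:
  assumes "chain P L (A \<union> B)" "tight P"
  shows "\<exists>Cs Es G. L = Cs @ Es \<and> length Es \<le> 1 \<and> tight G \<and> (\<forall>F. tight F \<longrightarrow> F \<subseteq> G) \<and>
    (\<forall>T\<in>set Cs. balanced T) \<and> (\<forall>T\<in>set Es. vertical T) \<and>
    (\<Union>T\<in>set Cs. verts T) = G - P \<and> (\<Union>T\<in>set Es. verts T) = A \<union> B - G"
  using assms
proof (induction L arbitrary: P)
  case Nil
  then show ?case
    using tight_subset by (intro exI[of _ "[]"] exI[of _ P]) simp
next
  case (Cons T L)
  then obtain F where F: "elementary P F" "T = brick_of (F - P)" "chain F L (A \<union> B)" by auto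
  have PF: "cut P" "cut F" "P \<subset> F" using F(1) by (auto simp: elementary_def)
  have vT: "verts T = F - P" using verts_block[OF PF(2)] F(2) by simp
  have gT: "gain F = gain P + int (card (col T)) - int (card (row T))"
    using gain_block[of P F] PF(3) F(2) by auto
  show ?case
  proof (cases "tight F")
    case True
    obtain Cs Es G where IH: "L = Cs @ Es" "length Es \<le> 1" "tight G" "\<forall>F. tight F \<longrightarrow> F \<subseteq> G"
      "\<forall>T\<in>set Cs. balanced T" "\<forall>T\<in>set Es. vertical T"
      "(\<Union>T\<in>set Cs. verts T) = G - F" "(\<Union>T\<in>set Es. verts T) = A \<union> B - G"
      using Cons.IH[OF F(3) True] by (elim exE conjE) (rule that)
    have "balanced T" using gT tight_gain_eq[OF Cons.prems(2) True] by (simp add: balanced_def)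
    moreover have "F \<subseteq> G" using IH(4) True by blast
    then have "(\<Union>T\<in>set (T # Cs). verts T) = G - P" using IH(7) vT PF(3) by auto
    ultimately show ?thesis
      using IH by (intro exI[of _ "T # Cs"] exI[of _ Es] exI[of _ G]) simp
  next
    case False
    then have FV: "F = A \<union> B" using PF by (auto simp: cut_def)
    have "L = []"
    proof (cases L)
      case (Cons S L')
      then obtain F' where "elementary F F'" using F(3) by auto
      then have "cut F'" "F \<subset> F'" by (auto simp: elementary_def)
      then show ?thesis using cut_subset[of F'] FV by blast
    qed
    \<comment> \<open>\<open>F' \<union> P\<close> is tight and lies between the ends of the last
      step, of which only \<open>P\<close> is tight.\<close>
    moreover have "F' \<subseteq> P" if "tight F'" for F'
    proof -
      have t: "tight (F' \<union> P)" using tight_Un that Cons.prems(2) by blast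
      then have "F' \<union> P = P \<or> F' \<union> P = F"
        using F(1) tight_subset[OF t] FV unfolding elementary_def by (simp add: cut_def)
      then show ?thesis using t False by blast
    qed
    moreover have "vertical T"
      using gT tight_gain_less[OF Cons.prems(2) cut_closed[OF PF(2)] False] by (simp add: vertical_def)
    ultimately show ?thesis
      using Cons.prems(2) vT FV by (intro exI[of _ "[]"] exI[of _ "[T]"] exI[of _ P]) simp
  qed
qed

text \<open>\<open>D\<close> is absent if the empty set is tight. Otherwise the first step ends in a
  tight set, the least one since nothing lies strictly between, and the rise in gain makes the block
  horizontal.\<close>

lemma chain_structure:
  assumes "chain {} L (A \<union> B)"
  obtains Ds Cs Es H G where "L = Ds @ Cs @ Es" "length Ds \<le> 1" "length Es \<le> 1"
    "tight H" "\<forall>F. tight F \<longrightarrow> H \<subseteq> F" "tight G" "\<forall>F. tight F \<longrightarrow> F \<subseteq> G"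
    "\<forall>T\<in>set Ds. horizontal T" "\<forall>T\<in>set Cs. balanced T" "\<forall>T\<in>set Es. vertical T"
    "(\<Union>T\<in>set Ds. verts T) = H" "(\<Union>T\<in>set Cs. verts T) = G - H"
    "(\<Union>T\<in>set Es. verts T) = A \<union> B - G"
proof (cases "tight {}")
  case True
  obtain Cs Es G where "L = Cs @ Es" "length Es \<le> 1" "tight G" "\<forall>F. tight F \<longrightarrow> F \<subseteq> G"
    "\<forall>T\<in>set Cs. balanced T" "\<forall>T\<in>set Es. vertical T"
    "(\<Union>T\<in>set Cs. verts T) = G - {}" "(\<Union>T\<in>set Es. verts T) = A \<union> B - G"
    using chain_above[OF assms True] by (elim exE conjE) (rule that)
  then show ?thesis using that[of "[]" Cs Es "{}" G] True by simp
next
  case False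
  obtain T L' where L: "L = T # L'"
  proof (cases L)
    case Nil
    then have "A \<union> B = {}" using assms by auto
    then show ?thesis using ex_tight tight_subset False by auto
  qed
  obtain F where F: "elementary {} F" "T = brick_of (F - {})" "chain F L' (A \<union> B)"
    using assms L by auto
  have tF: "tight F" using elementary_tight[OF F(1)] False by blast
  have cF: "cut F" using F(1) by (simp add: elementary_def)
  obtain Cs Es G where C: "L' = Cs @ Es" "length Es \<le> 1" "tight G" "\<forall>F. tight F \<longrightarrow> F \<subseteq> G"
    "\<forall>T\<in>set Cs. balanced T" "\<forall>T\<in>set Es. vertical T"
    "(\<Union>T\<in>set Cs. verts T) = G - F" "(\<Union>T\<in>set Es. verts T) = A \<union> B - G"
    using chain_above[OF F(3) tF] by (elim exE conjE) (rule that)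
  have least: "F \<subseteq> F'" if "tight F'" for F'
  proof -
    have t: "tight (F' \<inter> F)" using tight_Int that tF by blast
    then have "F' \<inter> F = {} \<or> F' \<inter> F = F" using F(1) unfolding elementary_def by (simp add: cut_def)
    then show ?thesis using t False by auto
  qed
  have "gain F = gain {} + int (card (col T)) - int (card (row T))"
    using gain_block[of "{}" F] F(2) by simp
  then have "horizontal T"
    using tight_gain_less[OF tF closed_empty False] by (simp add: horizontal_def)
  moreover have "verts T = F" using verts_block[OF cF, of "{}"] F(2) by simp
  ultimately show ?thesis using that[of "[T]" Cs Es F G] C L least tF by simp
qed

section \<open>Blocks and their components\<close>

lemma block_facts:
  assumes "elementary P Q"
  defines "T \<equiv> brick_of (Q - P)"
  shows "internally_joined E T" "solid E T" "finite (row T)" "finite (col T)"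
    "row T \<inter> col T = {}" "verts T = Q - P"
  using assms internally_joined_block[of P Q] solid_if_elementary[of P Q] verts_block[of Q P] disj
  by (auto simp: elementary_def)

lemma component_facts:
  assumes "elementary P Q" "K \<in> component_bricks E (brick_of (Q - P))"
  shows "is_brick A B K" "connected_on E (verts K)" "solid E K" "excessive E K" "atomic E K"
    "\<not> balanced (brick_of (Q - P)) \<Longrightarrow> \<not> balanced K" "verts K \<subseteq> Q - P"
    "row K = row (brick_of (Q - P)) \<inter> verts K" "col K = col (brick_of (Q - P)) \<inter> verts K"
proof -
  let ?T = "brick_of (Q - P)"
  note T = block_facts[OF assms(1)]
  obtain K: "verts K \<in> verts ?T // connection E (verts ?T)"
    and rc: "row K = row ?T \<inter> verts K" "col K = col ?T \<inter> verts K"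
    using assms(2) by (rule component_bricksE)
  note ne = component_nonempty[OF T(1) assms(2)]
  show "row K = row ?T \<inter> verts K" "col K = col ?T \<inter> verts K" by fact+
  show "is_brick A B K" unfolding is_brick_def using ne rc by auto
  show con: "connected_on E (verts K)" using component_props(3)[OF K] .
  note s = component_of_solid[OF T(1) assms(2) T(3,4,5,2)]
  show "solid E K" by (rule s(1))
  show "\<not> balanced ?T \<Longrightarrow> \<not> balanced K" by (rule s(3))
  have "finite (row K)" "finite (col K)" using rc T(3,4) by (metis finite_Int)+
  then show ex: "excessive E K" using excessive_if_solid ne(1) s(1) by blast
  show "atomic E K" using con ex by (auto simp: atomic_def m_atomic_def excessive_def)
  show "verts K \<subseteq> Q - P" using component_props(1)[OF K] T(6) by simp
qed

lemma balanced_block: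
  assumes "elementary P Q" "balanced (brick_of (Q - P))"
  shows "connected_on E (verts (brick_of (Q - P)))"
    "component_bricks E (brick_of (Q - P)) = {brick_of (Q - P)}"
proof -
  note T = block_facts[OF assms(1)]
  have "verts (brick_of (Q - P)) \<noteq> {}" using T(6) assms(1) by (auto simp: elementary_def)
  then show "connected_on E (verts (brick_of (Q - P)))"
    using connected_if_balanced_solid[OF T(1,3,4,5,2) assms(2)] by blast
  then show "component_bricks E (brick_of (Q - P)) = {brick_of (Q - P)}"
    by (rule component_bricks_connected)
qed

text \<open>A balanced block is its own only component, so the case distinction in the definition
  disappears.\<close>

lemma atomic_blocks_chain:
  assumes "chain {} L (A \<union> B)"
  shows "atomic_blocks E L = (\<Union>T\<in>set L. component_bricks E T)"
proof -
  have "component_bricks E T = {T}" if "T \<in> set L" "balanced T" for T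
    using chain_members[OF assms that(1)] balanced_block(2) that(2) by metis
  then show ?thesis unfolding atomic_blocks_def by auto
qed

lemma atomic_blocksE:
  assumes "chain {} L (A \<union> B)" "K \<in> atomic_blocks E L"
  obtains P Q where "elementary P Q" "brick_of (Q - P) \<in> set L" "K \<in> component_bricks E (brick_of (Q - P))"
proof -
  obtain T where T: "T \<in> set L" "K \<in> component_bricks E T"
    using assms(2) unfolding atomic_blocks_chain[OF assms(1)] by blast
  obtain P Q where "elementary P Q" "T = brick_of (Q - P)" using chain_members[OF assms(1) T(1)] by metis
  then show ?thesis using T that by blast
qed

section \<open>Maximum matchings restricted to components\<close>

lemma matching_within_block:
  assumes "maximum_matching E M" "elementary P Q" "K \<in> component_bricks E (brick_of (Q - P))" "e \<in> M"
  shows "e \<subseteq> verts K \<or> e \<inter> verts K = {}"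
proof -
  have m: "matching E M" using assms(1) by (simp add: maximum_matching_def)
  obtain x y where xy: "e = {x, y}" "x \<in> A" "y \<in> B" using matchingD[OF m assms(4)] by (rule edgeE) blast
  have yx: "e = {y, x}" using xy(1) by auto
  \<comment> \<open>A trivial cut contains all vertices or none, and a tight one is not crossed by
    \<open>M\<close>. So the edge lies within the step or outside of it, and within a step no edge
    leaves a component.\<close>
  have "e \<subseteq> F \<or> e \<inter> F = {}" if "cut F" for F
    using that maximum_matching_no_cross[OF assms(1) _ assms(4)] xy unfolding cut_def by auto
  then have "e \<subseteq> Q \<or> e \<inter> Q = {}" "e \<subseteq> P \<or> e \<inter> P = {}" using assms(2) by (auto simp: elementary_def)
  then have e: "e \<subseteq> Q - P \<or> e \<inter> (Q - P) = {}" by blast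
  have vT: "verts (brick_of (Q - P)) = Q - P" by (rule block_facts(6)[OF assms(2)])
  obtain K: "verts K \<in> (Q - P) // connection E (Q - P)"
    using assms(3) by (rule component_bricksE) (simp add: vT)
  note cp = component_props[OF K]
  have "{x, y} \<in> E" "{y, x} \<in> E" using matchingD[OF m assms(4)] xy(1) yx by auto
  then show ?thesis using e cp(1) cp(4)[of x y] cp(4)[of y x] xy(1) by auto
qed

lemma matched_block_card:
  assumes "maximum_matching E M" "elementary P Q" "K \<in> component_bricks E (brick_of (Q - P))"
  shows "small K \<le> card {e \<in> M. e \<subseteq> verts K}"
proof -
  let ?N = "{e \<in> M. e \<subseteq> verts K}"
  have m: "matching E M" using assms(1) by (simp add: maximum_matching_def)
  have fin: "finite ?N" using finite_subset[OF _ finite_E] matchingD[OF m] by (metis (no_types, lifting) mem_Collect_eq subsetI)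
  note c = component_facts[OF assms(2,3)]
  have le: "card S \<le> card ?N" if S: "S \<subseteq> \<Union>M" "S \<subseteq> verts K" "S \<subseteq> A \<or> S \<subseteq> B" for S
  proof (rule card_saturated_le[OF fin])
    show "S \<subseteq> \<Union>?N"
    proof
      fix s assume s: "s \<in> S"
      then obtain e where e: "e \<in> M" "s \<in> e" using S(1) by blast
      then have "e \<subseteq> verts K" using matching_within_block[OF assms e(1)] s S(2) by blast
      then show "s \<in> \<Union>?N" using e by blast
    qed
    fix e u v assume "e \<in> ?N" and uv: "u \<in> e \<inter> S" "v \<in> e \<inter> S"
    then obtain x y where "x \<in> A" "y \<in> B" "e = {x, y}" using matchingD[OF m] edgeE by (metis (no_types, lifting) mem_Collect_eq)
    then show "u = v" using uv S(3) disj by auto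
  qed
  show ?thesis
  \<comment> \<open>One end is tight, and its cover contains a whole side of \<open>K\<close>: the
    rows if it is \<open>Q\<close>, the columns if it is \<open>P\<close>. The matching edges at
    this side stay in \<open>K\<close>.\<close>
  proof (cases "tight Q")
    case True
    have "row K \<subseteq> B \<inter> Q" using c(8) by auto
    then have "card (row K) \<le> card ?N"
      using maximum_matching_saturates[OF assms(1) True] by (intro le) (auto simp: verts_def)
    then show ?thesis by (simp add: small_def)
  next
    case False
    then have "tight P" using elementary_tight[OF assms(2)] by blast
    moreover have "col K \<subseteq> A - P" using c(9) by auto
    ultimately have "card (col K) \<le> card ?N"
      using maximum_matching_saturates[OF assms(1), of P] by (intro le) (auto simp: verts_def)
    then show ?thesis by (simp add: small_def)
  qed
qed

lemma small_matching:
  assumes "elementary P Q" "K \<in> component_bricks E (brick_of (Q - P))"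
  shows "\<exists>N. matching (induced_edges E K) N \<and> card N = small K"
proof -
  obtain M where M: "maximum_matching E M" using ex_maximum_matching by blast
  have m: "matching E M" using M by (simp add: maximum_matching_def)
  obtain N where N: "N \<subseteq> {e \<in> M. e \<subseteq> verts K}" "card N = small K"
    by (rule obtain_subset_with_card_n[OF matched_block_card[OF M assms]])
  have "N \<subseteq> induced_edges E K"
  proof
    fix e assume "e \<in> N"
    then have "e \<in> M" "e \<subseteq> verts K" using N(1) by auto
    then show "e \<in> induced_edges E K" using matchingD[OF m] by (simp add: induced_edges_def)
  qed
  moreover have "e \<inter> f = {}" if "e \<in> N" "f \<in> N" "e \<noteq> f" for e f
  proof -
    have "e \<in> M" "f \<in> M" using N(1) that by auto
    then show ?thesis using m that(3) by (simp add: matching_def)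
  qed
  ultimately have "matching (induced_edges E K) N" by (simp add: matching_def)
  then show ?thesis using N(2) by blast
qed

lemma maximum_matching_of_block:
  assumes "maximum_matching E M" "elementary P Q" "K \<in> component_bricks E (brick_of (Q - P))"
  shows "maximum_matching (induced_edges E K) {e \<in> M. e \<subseteq> verts K}"
proof -
  let ?N = "{e \<in> M. e \<subseteq> verts K}"
  have m: "matching E M" using assms(1) by (simp add: maximum_matching_def)
  have mdis: "e \<inter> f = {}" if "e \<in> M" "f \<in> M" "e \<noteq> f" for e f
    using m that by (simp add: matching_def)
  have "matching (induced_edges E K) ?N"
    unfolding matching_def induced_edges_def
  proof (intro conjI ballI impI)
    show "?N \<subseteq> {e \<in> E. e \<subseteq> verts K}" using matchingD[OF m] by blast
    show "e \<inter> f = {}" if "e \<in> ?N" "f \<in> ?N" "e \<noteq> f" for e f using mdis that by blast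
  qed
  moreover have "card N' \<le> card ?N" if N': "matching (induced_edges E K) N'" for N'
  proof -
    have N'E: "e \<in> E" "e \<subseteq> verts K" if "e \<in> N'" for e
      using matchingD[OF N' that] by (auto simp: induced_edges_def)
    have N'dis: "e \<inter> f = {}" if "e \<in> N'" "f \<in> N'" "e \<noteq> f" for e f
      using N' that by (simp add: matching_def)
    have mixed: "e \<inter> f = {}" if "e \<in> M - ?N" "f \<in> N'" for e f
      using matching_within_block[OF assms, of e] that N'E(2)[of f] by blast
    \<comment> \<open>Exchange: an edge of \<open>M\<close> is inside \<open>K\<close> or disjoint
      from it, so the part in \<open>K\<close> may be replaced with any matching of
      \<open>K\<close>; a larger one would enlarge \<open>M\<close>.\<close>
    have "matching E ((M - ?N) \<union> N')"
      unfolding matching_def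
    proof (intro conjI ballI impI)
      show "(M - ?N) \<union> N' \<subseteq> E" using matchingD[OF m] N'E(1) by blast
      show "e \<inter> f = {}" if "e \<in> (M - ?N) \<union> N'" "f \<in> (M - ?N) \<union> N'" "e \<noteq> f" for e f
      proof (cases "e \<in> N'"; cases "f \<in> N'")
        assume "e \<in> N'" "f \<notin> N'"
        then show ?thesis using mixed[of f e] that by blast
      qed (use that N'dis mixed[of e f] mdis in blast)+
    qed
    then have "card ((M - ?N) \<union> N') \<le> card M" using assms(1) by (simp add: maximum_matching_def)
    moreover have finM: "finite M" using finite_subset[OF _ finite_E] matchingD[OF m] by blast
    moreover have finN': "finite N'" using finite_subset[OF _ finite_E] N'E(1) by blast
    moreover have "(M - ?N) \<inter> N' = {}"
    proof -
      have "e \<noteq> {}" if "e \<in> N'" for e using N'E(1)[OF that] by (rule edgeE) simp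
      then show ?thesis using mixed by fastforce
    qed
    ultimately have "card (M - ?N) + card N' \<le> card M" by (subst (asm) card_Un_disjoint) auto
    moreover have "card (M - ?N) = card M - card ?N" "card ?N \<le> card M"
      using finM by (auto intro!: card_Diff_subset card_mono)
    ultimately show ?thesis by linarith
  qed
  ultimately show ?thesis by (simp add: maximum_matching_def)
qed

end
section \<open>The atomic decomposition\<close>

lemma btf_disjoint:
  assumes "btf A B E L" "S \<in> set L" "T \<in> set L" "S \<noteq> T"
  shows "verts S \<inter> verts T = {}"
proof -
  obtain i j where ij: "i < length L" "j < length L" "S = L ! i" "T = L ! j"
    using assms(2,3) by (auto simp: in_set_conv_nth)
  have s: "precedes E (L ! k) (L ! l)" if "k < l" "l < length L" for k l
    using assms(1) that by (simp add: btf_iff sorted_wrt_iff_nth_less)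
  have "i < j \<or> j < i" using ij assms(4) by (metis linorder_neqE_nat)
  then show ?thesis using s[of i j] s[of j i] ij by (auto simp: precedes_def)
qed

lemma verts_components: "(\<Union>S\<in>component_bricks E T. verts S) = verts T"
proof (intro equalityI subsetI)
  fix v assume "v \<in> (\<Union>S\<in>component_bricks E T. verts S)"
  then obtain S where S: "S \<in> component_bricks E T" "v \<in> verts S" by blast
  obtain "verts S \<in> verts T // connection E (verts T)" using S(1) by (rule component_bricksE)
  then show "v \<in> verts T" using component_props(1) S(2) by blast
next
  fix v assume "v \<in> verts T"
  then show "v \<in> (\<Union>S\<in>component_bricks E T. verts S)"
    using component_bricks_cover[of v T E] by simp
qed

lemma component_verts_subset: "S \<in> component_bricks E T \<Longrightarrow> verts S \<subseteq> verts T"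
  by (erule component_bricksE) (rule component_props(1))

lemma finite_component_bricks:
  assumes "finite (verts T)"
  shows "finite (component_bricks E T)"
proof -
  have "verts T // connection E (verts T) \<subseteq> Pow (verts T)" using component_props(1) by blast
  then have "finite (verts T // connection E (verts T))" using assms by (simp add: finite_subset)
  then show ?thesis unfolding component_bricks_def Setcompr_eq_image by simp
qed

lemma m_atomic_characteristic: "atomic E T \<Longrightarrow> m_atomic E (characteristic E T) T"
  by (auto simp: atomic_def m_atomic_def m_excessive_def)

context bipartition_full
begin

lemma excessive_decomposition_chain:
  assumes "excessive_decomposition A B E L" "A \<union> B \<noteq> {}"
  shows "chain {} L (A \<union> B)"
proof -
  have "Brick B A = brick_of (A \<union> B - {})" by (simp add: brick_of_def Int_absorb2)
  then show ?thesis
    using assms decomposes_chain[of "Brick B A" L "A \<union> B" "{}"]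
    by (auto simp: excessive_decomposition_def cut_def)
qed

lemma ex_excessive_decomposition:
  assumes "A \<union> B \<noteq> {}"
  shows "\<exists>L. excessive_decomposition A B E L"
proof -
  have "Brick B A = brick_of (A \<union> B - {})" by (simp add: brick_of_def Int_absorb2)
  then show ?thesis
    using assms ex_decomposes[of "{}" "A \<union> B"] by (auto simp: excessive_decomposition_def cut_def)
qed

text \<open>Blocks hand their order down to their components, and the components of one block may
  come in any order. As \<open>Ds\<close> and \<open>Es\<close> have at most one member each, any
  enumeration of their components fits.\<close>

lemma refined_btf:
  assumes "chain {} L (A \<union> B)" "L = Ds @ Cs @ Es" "length Ds \<le> 1" "length Es \<le> 1"
    "\<forall>T\<in>set Cs. balanced T"
    and "distinct Dcs" "set Dcs = (\<Union>T\<in>set Ds. component_bricks E T)"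
    and "distinct Ecs" "set Ecs = (\<Union>T\<in>set Es. component_bricks E T)"
  shows "btf A B E (Dcs @ Cs @ Ecs)"
proof -
  have L: "btf A B E L" by (rule chain_is_btf[OF assms(1)])
  have el: "\<exists>P Q. elementary P Q \<and> T = brick_of (Q - P)" if "T \<in> set L" for T
    using chain_members[OF assms(1) that] by metis
  have Cs: "T \<in> component_bricks E T" if "T \<in> set Cs" for T
    using el[of T] balanced_block(2) that assms(2,5) by fastforce
  have brick: "is_brick A B K" if "K \<in> component_bricks E T" "T \<in> set L" for K T
    using el[OF that(2)] component_facts(1) that(1) by blast
  have sub: "sorted_wrt (precedes E) X"
    if "distinct X" "set X = (\<Union>T\<in>set Y. component_bricks E T)" "length Y \<le> 1" for X Y
  proof (cases Y)
    case (Cons T Z)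
    then show ?thesis using that sorted_components[of X E T] by simp
  qed (use that in simp)
  have pre: "sorted_wrt (precedes E) Cs" "\<forall>S\<in>set Ds. \<forall>T\<in>set Cs \<union> set Es. precedes E S T"
    "\<forall>S\<in>set Cs. \<forall>T\<in>set Es. precedes E S T"
    using L unfolding btf_iff assms(2) by (auto simp: sorted_wrt_append)
  have "sorted_wrt (precedes E) (Dcs @ Cs @ Ecs)"
    unfolding sorted_wrt_append
  proof (intro conjI ballI)
    show "precedes E S T" if "S \<in> set Dcs" "T \<in> set (Cs @ Ecs)" for S T
    proof -
      obtain S' where S': "S' \<in> set Ds" "S \<in> component_bricks E S'" using \<open>S \<in> set Dcs\<close> assms(7) by blast
      obtain T' where T': "T' \<in> set Cs \<union> set Es" "T \<in> component_bricks E T'"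
        using \<open>T \<in> set (Cs @ Ecs)\<close> assms(9) Cs by auto
      have "precedes E S' T'" using pre(2) S'(1) T'(1) by blast
      then show ?thesis using S'(2) T'(2) by (rule precedes_components_of)
    qed
    show "precedes E S T" if "S \<in> set Cs" "T \<in> set Ecs" for S T
    proof -
      obtain T' where T': "T' \<in> set Es" "T \<in> component_bricks E T'" using \<open>T \<in> set Ecs\<close> assms(9) by blast
      have "precedes E S T'" using pre(3) T'(1) \<open>S \<in> set Cs\<close> by blast
      then show ?thesis using Cs[OF \<open>S \<in> set Cs\<close>] T'(2) by (rule precedes_components_of)
    qed
    show "sorted_wrt (precedes E) Dcs" using sub assms by blast
    show "sorted_wrt (precedes E) Cs" by (rule pre(1))
    show "sorted_wrt (precedes E) Ecs" using sub assms by blast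
  qed
  moreover have "is_brick A B T" if "T \<in> set (Dcs @ Cs @ Ecs)" for T
    using that brick Cs unfolding set_append assms(7,9) assms(2) by blast
  moreover have "(\<Union>T\<in>set (Dcs @ Cs @ Ecs). verts T) = (\<Union>T\<in>set L. verts T)"
  proof -
    have "(\<Union>S\<in>(\<Union>T\<in>X. component_bricks E T). verts S) = (\<Union>T\<in>X. verts T)" for X
      using verts_components[of E] by auto
    from this[of "set Ds"] this[of "set Es"] show ?thesis
      unfolding set_append UN_Un assms(2,7,9) by simp
  qed
  ultimately show ?thesis using L unfolding btf_iff by simp
qed

lemma atomic_blocks_parts:
  assumes "chain {} L (A \<union> B)" "L = Ds @ Cs @ Es" "\<forall>T\<in>set Cs. balanced T"
  shows "atomic_blocks E L = (\<Union>T\<in>set Ds. component_bricks E T) \<union> set Cs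
    \<union> (\<Union>T\<in>set Es. component_bricks E T)"
proof -
  have "component_bricks E T = {T}" if "T \<in> set Cs" for T
  proof -
    have "T \<in> set L" using that assms(2) by simp
    then obtain P Q where "elementary P Q" "T = brick_of (Q - P)" using chain_members[OF assms(1)] by metis
    then show ?thesis using balanced_block(2) that assms(3) by blast
  qed
  then have "(\<Union>T\<in>set L. component_bricks E T) = (\<Union>T\<in>set Ds. component_bricks E T) \<union> set Cs
    \<union> (\<Union>T\<in>set Es. component_bricks E T)"
    unfolding assms(2) by auto
  then show ?thesis using atomic_blocks_chain[OF assms(1)] by simp
qed

lemma atomic_btf:
  assumes "chain {} L (A \<union> B)"
  shows "\<exists>L'. btf A B E L' \<and> set L' = atomic_blocks E L"
proof -
  obtain Ds Cs Es H G where s: "L = Ds @ Cs @ Es" "length Ds \<le> 1" "length Es \<le> 1"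
    "\<forall>T\<in>set Cs. balanced T"
    by (rule chain_structure[OF assms]) (rule that)
  have "finite (component_bricks E T)" if "T \<in> set L" for T
  proof (rule finite_component_bricks)
    have "verts T \<subseteq> A \<union> B" using chain_verts[OF assms] that by blast
    then show "finite (verts T)" by (rule finite_subset) simp
  qed
  then have "finite (\<Union>T\<in>set Ds. component_bricks E T)" "finite (\<Union>T\<in>set Es. component_bricks E T)"
    using s(1) by auto
  then obtain Dcs Ecs where x: "distinct Dcs" "set Dcs = (\<Union>T\<in>set Ds. component_bricks E T)"
    "distinct Ecs" "set Ecs = (\<Union>T\<in>set Es. component_bricks E T)"
    by (metis finite_distinct_list)
  have "btf A B E (Dcs @ Cs @ Ecs)" by (rule refined_btf[OF assms s x])
  moreover have "set (Dcs @ Cs @ Ecs) = atomic_blocks E L"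
    unfolding atomic_blocks_parts[OF assms s(1,4)] set_append x(2,4) by blast
  ultimately show ?thesis by blast
qed

section \<open>Regions and atomic blocks\<close>

lemma regions:
  assumes "maximum_matching E M" "tight H" "\<forall>F. tight F \<longrightarrow> H \<subseteq> F" "tight G" "\<forall>F. tight F \<longrightarrow> F \<subseteq> G"
  shows "dm_D A B E M = H" "dm_C A B E M = G - H" "dm_E A B E M = A \<union> B - G"
proof -
  show D: "dm_D A B E M = H" by (rule dm_D_eq[OF assms(1-3)])
  show Er: "dm_E A B E M = A \<union> B - G" by (rule dm_E_eq[OF assms(1,4,5)])
  have "G \<subseteq> A \<union> B" using tight_subset assms(4) by blast
  then show "dm_C A B E M = G - H" unfolding dm_C_def D Er by blast
qed

lemma regions_disjoint:
  assumes "chain {} L (A \<union> B)" "maximum_matching E M" "R \<in> dm_regions A B E M" "R' \<in> dm_regions A B E M" "R \<noteq> R'"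
  shows "R \<inter> R' = {}"
proof -
  obtain Ds Cs Es H G where t: "tight H" "\<forall>F. tight F \<longrightarrow> H \<subseteq> F" "tight G" "\<forall>F. tight F \<longrightarrow> F \<subseteq> G"
    by (rule chain_structure[OF assms(1)]) (rule that)
  have "H \<subseteq> G" using t(2,3) by blast
  then show ?thesis
    using assms(3-5) unfolding dm_regions_def regions[OF assms(2) t] by blast
qed

lemma atomic_block_in_region:
  assumes "chain {} L (A \<union> B)" "K \<in> atomic_blocks E L" "maximum_matching E M"
  shows "\<exists>R\<in>dm_regions A B E M. verts K \<subseteq> R"
proof -
  obtain Ds Cs Es H G where L: "L = Ds @ Cs @ Es"
    and t: "tight H" "\<forall>F. tight F \<longrightarrow> H \<subseteq> F" "tight G" "\<forall>F. tight F \<longrightarrow> F \<subseteq> G"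
    and v: "(\<Union>T\<in>set Ds. verts T) = H" "(\<Union>T\<in>set Cs. verts T) = G - H"
      "(\<Union>T\<in>set Es. verts T) = A \<union> B - G"
    by (rule chain_structure[OF assms(1)]) (rule that)
  obtain T where T: "T \<in> set L" "K \<in> component_bricks E T"
    using assms(2) unfolding atomic_blocks_chain[OF assms(1)] by blast
  have KT: "verts K \<subseteq> verts T" using T(2) by (rule component_verts_subset)
  have "T \<in> set Ds \<or> T \<in> set Cs \<or> T \<in> set Es" using T(1) L by simp
  then have "verts T \<subseteq> H \<or> verts T \<subseteq> G - H \<or> verts T \<subseteq> A \<union> B - G"
    using UN_upper[of T "set Ds" verts] UN_upper[of T "set Cs" verts] UN_upper[of T "set Es" verts]
    unfolding v by blast
  moreover have "dm_regions A B E M = {H, G - H, A \<union> B - G}"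
    unfolding dm_regions_def regions[OF assms(3) t] ..
  ultimately show ?thesis using KT by auto
qed

lemma different_regions_D_E:
  assumes "chain {} L (A \<union> B)" "T \<in> set L" "horizontal T" "T' \<in> set L" "vertical T'"
    and "S \<in> component_bricks E T" "S' \<in> component_bricks E T'"
  shows "different_regions A B E S S'"
proof -
  obtain Ds Cs Es H G where L: "L = Ds @ Cs @ Es"
    and t: "tight H" "\<forall>F. tight F \<longrightarrow> H \<subseteq> F" "tight G" "\<forall>F. tight F \<longrightarrow> F \<subseteq> G"
    and h: "\<forall>T\<in>set Ds. horizontal T" "\<forall>T\<in>set Cs. balanced T" "\<forall>T\<in>set Es. vertical T"
    and v: "(\<Union>T\<in>set Ds. verts T) = H" "(\<Union>T\<in>set Cs. verts T) = G - H"
      "(\<Union>T\<in>set Es. verts T) = A \<union> B - G"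
    by (rule chain_structure[OF assms(1)]) (rule that)
  obtain M where M: "maximum_matching E M" using ex_maximum_matching by blast
  have "T \<in> set Ds" "T' \<in> set Es"
    using assms(2-5) h unfolding L horizontal_def vertical_def balanced_def by force+
  then have "verts T \<subseteq> H" "verts T' \<subseteq> A \<union> B - G" using v by auto
  moreover have "verts S \<subseteq> verts T" "verts S' \<subseteq> verts T'"
    using assms(6,7) by (simp_all add: component_verts_subset)
  moreover obtain "verts S \<in> verts T // connection E (verts T)" using assms(6) by (rule component_bricksE)
  then have "verts S \<noteq> {}" by (rule component_props(2))
  \<comment> \<open>\<open>dm_regions\<close> is a set, in which equal regions coincide. These two
    differ because \<open>H\<close> contains the nonempty \<open>verts S\<close> and is disjoint
    from the complement of \<open>G\<close>.\<close>
  ultimately have "verts S \<subseteq> H" "verts S' \<subseteq> A \<union> B - G" "H \<noteq> A \<union> B - G" using t(2)[rule_format, OF t(3)] by auto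
  moreover have "dm_regions A B E M = {H, G - H, A \<union> B - G}"
    unfolding dm_regions_def regions[OF M t] ..
  ultimately show ?thesis
    using M unfolding different_regions_def by (intro exI[of _ M] exI[of _ H] exI[of _ "A \<union> B - G"]) simp
qed

lemma matching_decomposition:
  assumes "chain {} L (A \<union> B)" "maximum_matching E M"
  shows "\<exists>N. (\<forall>T\<in>atomic_blocks E L. maximum_matching (induced_edges E T) (N T)) \<and>
    (\<forall>S\<in>atomic_blocks E L. \<forall>T\<in>atomic_blocks E L. S \<noteq> T \<longrightarrow> N S \<inter> N T = {}) \<and>
    M = (\<Union>T\<in>atomic_blocks E L. N T)"
\<comment> \<open>The summand of a block consists of the edges of \<open>M\<close> inside it.
  Disjointness carries over from the blocks because edges are nonempty.\<close>
proof (intro exI[of _ "\<lambda>T. {e \<in> M. e \<subseteq> verts T}"] conjI ballI impI)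
  obtain L' where L': "btf A B E L'" "set L' = atomic_blocks E L" using atomic_btf[OF assms(1)] by blast
  have m: "matching E M" using assms(2) by (simp add: maximum_matching_def)
  have ne: "e \<noteq> {}" if "e \<in> M" for e using matchingD[OF m that] by (rule edgeE) simp
  show "maximum_matching (induced_edges E T) {e \<in> M. e \<subseteq> verts T}" if "T \<in> atomic_blocks E L" for T
    using atomic_blocksE[OF assms(1) that] maximum_matching_of_block[OF assms(2)] by metis
  show "{e \<in> M. e \<subseteq> verts S} \<inter> {e \<in> M. e \<subseteq> verts T} = {}"
    if "S \<in> atomic_blocks E L" "T \<in> atomic_blocks E L" "S \<noteq> T" for S T
    using btf_disjoint[OF L'(1), of S T] that L'(2) ne by blast
  show "M = (\<Union>T\<in>atomic_blocks E L. {e \<in> M. e \<subseteq> verts T})"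
  proof (intro equalityI subsetI)
    fix e assume e: "e \<in> M"
    obtain x where x: "x \<in> e" using ne[OF e] by blast
    have "x \<in> A \<union> B" using matchingD[OF m e] by (rule edgeE) (use x in auto)
    then have "x \<in> (\<Union>T\<in>atomic_blocks E L. verts T)" using L' by (simp add: btf_iff)
    then obtain T where T: "T \<in> atomic_blocks E L" "x \<in> verts T" by blast
    obtain P Q where "elementary P Q" "T \<in> component_bricks E (brick_of (Q - P))"
      using atomic_blocksE[OF assms(1) T(1)] by metis
    then have "e \<subseteq> verts T" using matching_within_block[OF assms(2) _ _ e] x T(2) by blast
    then show "e \<in> (\<Union>T\<in>atomic_blocks E L. {e \<in> M. e \<subseteq> verts T})" using e T(1) by blast
  qed blast
qed

text \<open>A matching edge that meets an atomic block lies inside it, so both its ends would be in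
  one region; distinct regions are disjoint.\<close>

lemma no_matching_between_regions:
  assumes "chain {} L (A \<union> B)" "S \<in> atomic_blocks E L" "T \<in> atomic_blocks E L"
    "different_regions A B E S T" "u \<in> verts S" "v \<in> verts T" "maximum_matching E M"
  shows "{u, v} \<notin> M"
proof
  assume e: "{u, v} \<in> M"
  obtain P Q where "elementary P Q" "S \<in> component_bricks E (brick_of (Q - P))"
    using atomic_blocksE[OF assms(1,2)] by metis
  then have "v \<in> verts S" using matching_within_block[OF assms(7) _ _ e] assms(5) by blast
  moreover obtain M' R R' where "maximum_matching E M'" "R \<in> dm_regions A B E M'" "R' \<in> dm_regions A B E M'"
    "R \<noteq> R'" "verts S \<subseteq> R" "verts T \<subseteq> R'"
    using assms(4) unfolding different_regions_def by blast
  ultimately show False using regions_disjoint[OF assms(1), of M' R R'] assms(6) by blast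
qed

end
section \<open>An example with disconnected blocks\<close>

text \<open>
  The stars with centres 6 and 7 make up the horizontal block, the stars with centres 4 and 5 the
  vertical one. The remaining edges \<open>{4, 6}\<close>, \<open>{4, 7}\<close>, \<open>{5, 6}\<close> only make the graph connected.
\<close>

definition cols13 :: "nat set" where "cols13 = {0, 1, 2, 3, 4, 5}"

definition rows13 :: "nat set" where "rows13 = {6, 7, 8, 9, 10, 11, 12}"

text \<open>Pairs with the column first turn adjacency into a finite table. Two leaves make a star
  unbalanced; the third leaf of 5 makes the characteristics differ. The connecting edges join rows
  of the horizontal block to columns of the vertical one, the direction that a BTF allows.\<close>

definition arcs13 :: "(nat \<times> nat) set" where
  "arcs13 = {(0, 6), (1, 6), (2, 7), (3, 7), (4, 6), (4, 7), (5, 6), (4, 8), (4, 9), (5, 10), (5, 11), (5, 12)}"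

definition edges13 :: "nat set set" where
  "edges13 = (\<lambda>(x, y). {x, y}) ` arcs13"

lemma edges13_iff: "{u, v} \<in> edges13 \<longleftrightarrow> (u, v) \<in> arcs13 \<or> (v, u) \<in> arcs13"
  unfolding edges13_def by (force simp: doubleton_eq_iff)

lemma arcs13_sub: "(x, y) \<in> arcs13 \<Longrightarrow> x \<in> cols13 \<and> y \<in> rows13"
  unfolding arcs13_def cols13_def rows13_def by auto

lemma bipartite13: "bipartite_graph cols13 rows13 edges13"
  unfolding bipartite_graph_def
proof (intro conjI)
  show "edges13 \<subseteq> {{x, y} |x y. x \<in> cols13 \<and> y \<in> rows13}"
    unfolding edges13_def using arcs13_sub by fastforce
qed (simp_all add: cols13_def rows13_def)

lemma isolated13:
  assumes "v \<in> cols13 \<union> rows13"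
  shows "\<exists>e\<in>edges13. v \<in> e"
proof -
  have "\<exists>w. (v, w) \<in> arcs13 \<or> (w, v) \<in> arcs13"
    using assms unfolding cols13_def rows13_def arcs13_def by (simp; elim disjE; auto)
  then obtain w where "{v, w} \<in> edges13" by (auto simp: edges13_iff)
  then show ?thesis by blast
qed

lemma connected13: "connected_on edges13 (cols13 \<union> rows13)"
proof -
  let ?c = "connection edges13 (cols13 \<union> rows13)"
  have e: "(x, y) \<in> ?c" "(y, x) \<in> ?c" if "(x, y) \<in> arcs13" for x y
  proof -
    have "{x, y} \<in> edges13" "x \<in> cols13 \<union> rows13" "y \<in> cols13 \<union> rows13"
      using that arcs13_sub by (auto simp: edges13_iff)
    then show "(x, y) \<in> ?c" by (rule connection_edge)
    then show "(y, x) \<in> ?c" by (rule connection_sym)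
  qed
  have a: "(0, 6) \<in> arcs13" "(1, 6) \<in> arcs13" "(2, 7) \<in> arcs13" "(3, 7) \<in> arcs13" "(4, 6) \<in> arcs13"
    "(4, 7) \<in> arcs13" "(5, 6) \<in> arcs13" "(4, 8) \<in> arcs13" "(4, 9) \<in> arcs13" "(5, 10) \<in> arcs13"
    "(5, 11) \<in> arcs13" "(5, 12) \<in> arcs13"
    by (simp_all add: arcs13_def)
  have c7: "(6, 7) \<in> ?c" using e(2)[OF a(5)] e(1)[OF a(6)] by (rule connection_trans)
  have c4: "(6, v) \<in> ?c" if "(4, v) \<in> arcs13" for v
    using e(2)[OF a(5)] e(1)[OF that] by (rule connection_trans)
  have c5: "(6, v) \<in> ?c" if "(5, v) \<in> arcs13" for v
    using e(2)[OF a(7)] e(1)[OF that] by (rule connection_trans)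
  have "(6, 2) \<in> ?c" "(6, 3) \<in> ?c"
    by (rule connection_trans[OF c7 e(2)[OF a(3)]], rule connection_trans[OF c7 e(2)[OF a(4)]])
  moreover have "v = 0 \<or> v = 1 \<or> v = 2 \<or> v = 3 \<or> v = 4 \<or> v = 5 \<or> v = 6 \<or> v = 7 \<or> v = 8 \<or> v = 9
      \<or> v = 10 \<or> v = 11 \<or> v = 12" if "v \<in> cols13 \<union> rows13" for v
    using that unfolding cols13_def rows13_def by simp blast
  ultimately have "(6, v) \<in> ?c" if "v \<in> cols13 \<union> rows13" for v
    using that e(2)[OF a(1)] e(2)[OF a(2)] e(2)[OF a(5)] e(2)[OF a(7)] c7 c4[OF a(8)] c4[OF a(9)]
      c5[OF a(10)] c5[OF a(11)] c5[OF a(12)] connection_refl[of 6 edges13 "cols13 \<union> rows13"]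
    by metis
  then have "(u, v) \<in> ?c" if "u \<in> cols13 \<union> rows13" "v \<in> cols13 \<union> rows13" for u v
    using that connection_sym[of 6 u] connection_trans[of u 6 _ _ v] by blast
  moreover have "cols13 \<union> rows13 \<noteq> {}" by (simp add: cols13_def)
  ultimately show ?thesis unfolding connected_on_def by blast
qed

lemma base13: "base_graph cols13 rows13 edges13"
  unfolding base_graph_def
proof (intro conjI ballI)
  show "\<exists>e\<in>edges13. v \<in> e" if "v \<in> cols13 \<union> rows13" for v using isolated13[OF that] .
  show "card cols13 \<le> card rows13" by (simp add: cols13_def rows13_def)
  have "{0, 7} \<notin> edges13" by (simp add: edges13_iff arcs13_def)
  then show "\<not> (\<forall>x\<in>cols13. \<forall>y\<in>rows13. {x, y} \<in> edges13)"
    by (auto simp: cols13_def rows13_def)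
qed (rule bipartite13 connected13)+

interpretation ex13: bipartition_full cols13 rows13 edges13
  by unfold_locales (fact bipartite13, fact isolated13)

definition D13 :: "nat brick" where "D13 = Brick {6, 7} {0, 1, 2, 3}"

definition E13 :: "nat brick" where "E13 = Brick {8, 9, 10, 11, 12} {4, 5}"

text \<open>A hole uses a single row, whose two leaves are excluded: at most 1 + 2 vertices against
  the long side 4.\<close>

lemma solid_D13: "solid edges13 D13"
  unfolding solid_def
proof (intro notI, elim exE conjE)
  fix W assume W: "hole edges13 D13 W" "long D13 \<le> vcount W"
  have free: "\<And>x y. x \<in> col W \<Longrightarrow> y \<in> row W \<Longrightarrow> (x, y) \<notin> arcs13"
    using W(1) by (auto simp: hole_def edges13_iff)
  have r: "row W \<noteq> {}" "row W \<subset> {6, 7}" and c: "col W \<subseteq> {0, 1, 2, 3}"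
    using W(1) by (auto simp: hole_def D13_def)
  have "card (row W) < card {6, 7 :: nat}" using r(2) by (intro psubset_card_mono) auto
  then have cr: "card (row W) < 2" by simp
  have "card (col W) \<le> 2"
  proof (cases "6 \<in> row W")
    case True
    then have "col W \<subseteq> {2, 3}" using c free[of 0 6] free[of 1 6] by (auto simp: arcs13_def)
    then have "card (col W) \<le> card {2, 3 :: nat}" by (intro card_mono) auto
    then show ?thesis by simp
  next
    case False
    then have "7 \<in> row W" using r by auto
    then have "col W \<subseteq> {0, 1}" using c free[of 2 7] free[of 3 7] by (auto simp: arcs13_def)
    then have "card (col W) \<le> card {0, 1 :: nat}" by (intro card_mono) auto
    then show ?thesis by simp
  qed
  then show False using W(2) cr by (simp add: long_def vcount_def D13_def)
qed

lemma solid_E13: "solid edges13 E13"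
  unfolding solid_def
proof (intro notI, elim exE conjE)
  fix W assume W: "hole edges13 E13 W" "long E13 \<le> vcount W"
  have free: "\<And>x y. x \<in> col W \<Longrightarrow> y \<in> row W \<Longrightarrow> (x, y) \<notin> arcs13"
    using W(1) by (auto simp: hole_def edges13_iff)
  have r: "row W \<subseteq> {8, 9, 10, 11, 12}" and c: "col W \<noteq> {}" "col W \<subset> {4, 5}"
    using W(1) by (auto simp: hole_def E13_def)
  have "card (col W) < card {4, 5 :: nat}" using c(2) by (intro psubset_card_mono) auto
  then have cc: "card (col W) < 2" by simp
  have "card (row W) \<le> 3"
  proof (cases "4 \<in> col W")
    case True
    then have "row W \<subseteq> {10, 11, 12}" using r free[of 4 8] free[of 4 9] by (auto simp: arcs13_def)
    then have "card (row W) \<le> card {10, 11, 12 :: nat}" by (intro card_mono) auto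
    then show ?thesis by simp
  next
    case False
    then have "5 \<in> col W" using c by auto
    then have "row W \<subseteq> {8, 9}"
      using r free[of 5 10] free[of 5 11] free[of 5 12] by (auto simp: arcs13_def)
    then have "card (row W) \<le> card {8, 9 :: nat}" by (intro card_mono) auto
    then show ?thesis by simp
  qed
  then show False using W(2) cc by (simp add: long_def vcount_def E13_def)
qed

lemma decomposition13: "excessive_decomposition cols13 rows13 edges13 [D13, E13]"
proof -
  let ?T = "Brick rows13 cols13" and ?V = "Brick {8, 9, 10, 11, 12} {0, 1, 2, 3} :: nat brick"
  have hole: "hole edges13 ?T ?V"
    unfolding hole_def brick.sel
  proof (intro conjI ballI)
    have "{8, 9, 10, 11, 12} \<subseteq> rows13" "6 \<in> rows13 - {8, 9, 10, 11, 12}" by (simp_all add: rows13_def)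
    then show "{8, 9, 10, 11, 12} \<subset> rows13" by blast
    have "{0, 1, 2, 3} \<subseteq> cols13" "4 \<in> cols13 - {0, 1, 2, 3}" by (simp_all add: cols13_def)
    then show "{0, 1, 2, 3} \<subset> cols13" by blast
    fix x y :: nat assume "x \<in> {0, 1, 2, 3}" "y \<in> {8, 9, 10, 11, 12}"
    then have "x < 4" "8 \<le> y" by auto
    moreover have "x < 4 \<Longrightarrow> y < 8" if "(x, y) \<in> arcs13 \<or> (y, x) \<in> arcs13"
      using that unfolding arcs13_def by auto
    ultimately show "{x, y} \<notin> edges13" unfolding edges13_iff by linarith
  qed simp_all
  have le: "vcount W \<le> vcount ?V" if W: "hole edges13 ?T W" for W
  proof -
    have WB: "row W \<subseteq> rows13" "col W \<subseteq> cols13"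
      and free: "\<And>x y. x \<in> col W \<Longrightarrow> y \<in> row W \<Longrightarrow> {x, y} \<notin> edges13"
      using W by (auto simp: hole_def)
    \<comment> \<open>Four disjoint edges bound every hole: the closed set belonging to
      \<open>W\<close> has a cover of \<open>13 - vcount W\<close> vertices, which must be at least
      4. So \<open>vcount W\<close> is at most 9, the vcount of \<open>?V\<close>.\<close>
    let ?M = "{{0, 6}, {2, 7}, {4, 8}, {5, 10}} :: nat set set" and ?F = "col W \<union> (rows13 - row W)"
    have disj: "cols13 \<inter> rows13 = {}" by (rule ex13.disj)
    have "matching edges13 ?M"
      unfolding matching_def by (simp add: edges13_iff arcs13_def)
    moreover have "ex13.closed ?F"
      unfolding ex13.closed_def
    proof (intro conjI ballI allI impI)
      show "?F \<subseteq> cols13 \<union> rows13" using WB by blast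
      fix x y assume x: "x \<in> cols13 \<inter> ?F" and e: "{x, y} \<in> edges13"
      then have "x \<in> col W" "y \<in> rows13" using disj ex13.edge_A[OF e] by auto
      then show "y \<in> ?F" using free e by blast
    qed
    ultimately have "card ?M \<le> card (rows13 \<inter> ?F) + card (cols13 - ?F)"
      by (rule ex13.matching_card_le)
    moreover have "rows13 \<inter> ?F = rows13 - row W" "cols13 - ?F = cols13 - col W" using WB disj by auto
    moreover have "card (rows13 - row W) = card rows13 - card (row W)" "card (row W) \<le> card rows13"
      "card (cols13 - col W) = card cols13 - card (col W)" "card (col W) \<le> card cols13"
      using WB finite_subset[OF _ ex13.fin_A] finite_subset[OF _ ex13.fin_B]
      by (simp_all add: card_Diff_subset card_mono)
    moreover have "card ?M = 4" by (simp add: doubleton_eq_iff)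
    moreover have "card rows13 = 7" "card cols13 = 6" by (simp_all add: rows13_def cols13_def)
    ultimately have "card (col W) + card (row W) \<le> 9" by simp
    then show ?thesis by (simp add: vcount_def)
  qed
  have "maximum_hole edges13 ?T ?V" using hole le by (simp add: maximum_hole_def)
  moreover have "long ?T \<le> vcount ?V" by (simp add: long_def vcount_def rows13_def cols13_def)
  moreover have "Brick (row ?T - row ?V) (col ?V) = D13" "Brick (row ?V) (col ?T - col ?V) = E13"
    by (simp_all add: rows13_def cols13_def D13_def E13_def insert_Diff_if)
  moreover have "decomposes edges13 D13 [D13]" "decomposes edges13 E13 [E13]"
    by (rule decomposes.block[OF solid_D13[unfolded solid_def]],
        rule decomposes.block[OF solid_E13[unfolded solid_def]])
  ultimately have "decomposes edges13 ?T ([D13] @ [E13])"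
    using hole by (intro decomposes.split[of edges13 ?T ?V]) (blast, simp_all)
  then show ?thesis by (simp add: excessive_decomposition_def)
qed

lemma component_brickI:
  assumes "c \<in> K" "K \<subseteq> verts T" "\<And>v. v \<in> K \<Longrightarrow> v = c \<or> {c, v} \<in> E"
    and "\<And>u v. u \<in> K \<Longrightarrow> v \<in> verts T \<Longrightarrow> {u, v} \<in> E \<Longrightarrow> v \<in> K"
  shows "Brick (row T \<inter> K) (col T \<inter> K) \<in> component_bricks E T"
proof -
  have "v \<in> K \<longleftrightarrow> (c, v) \<in> connection E (verts T)" for v
  proof
    assume "v \<in> K"
    then show "(c, v) \<in> connection E (verts T)"
      using assms(1-3) connection_refl[of c E] connection_edge[of c v E "verts T"] by (metis subsetD)
  next
    assume "(c, v) \<in> connection E (verts T)"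
    then show "v \<in> K" using assms(1,4) by (rule connection_closed)
  qed
  then have "K = connection E (verts T) `` {c}" by auto
  then have "K \<in> verts T // connection E (verts T)" using assms(1,2) by (auto simp: quotient_def)
  then show ?thesis by (auto simp: component_bricks_def)
qed

lemma component13_6: "Brick {6} {0, 1} \<in> component_bricks edges13 D13"
proof -
  have "Brick (row D13 \<inter> {0, 1, 6}) (col D13 \<inter> {0, 1, 6}) \<in> component_bricks edges13 D13"
  proof (rule component_brickI[of 6])
    show "v = 6 \<or> {6, v} \<in> edges13" if "v \<in> {0, 1, 6}" for v
      using that by (auto simp: edges13_iff arcs13_def)
    show "v \<in> {0, 1, 6}" if "u \<in> {0, 1, 6}" "v \<in> verts D13" "{u, v} \<in> edges13" for u v
      using that unfolding edges13_iff by (auto simp: arcs13_def verts_def D13_def)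
  qed (auto simp: verts_def D13_def)
  moreover have "row D13 \<inter> {0, 1, 6} = {6}" "col D13 \<inter> {0, 1, 6} = {0, 1}" by (auto simp: D13_def)
  ultimately show ?thesis by simp
qed

lemma component13_5: "Brick {10, 11, 12} {5} \<in> component_bricks edges13 E13"
proof -
  let ?K = "{5, 10, 11, 12} :: nat set"
  have "Brick (row E13 \<inter> ?K) (col E13 \<inter> ?K) \<in> component_bricks edges13 E13"
  proof (rule component_brickI[of 5])
    show "v = 5 \<or> {5, v} \<in> edges13" if "v \<in> ?K" for v
      using that by (auto simp: edges13_iff arcs13_def)
    show "v \<in> ?K" if "u \<in> ?K" "v \<in> verts E13" "{u, v} \<in> edges13" for u v
      using that unfolding edges13_iff by (auto simp: arcs13_def verts_def E13_def)
  qed (auto simp: verts_def E13_def)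
  moreover have "row E13 \<inter> ?K = {10, 11, 12}" "col E13 \<inter> ?K = {5}" by (auto simp: E13_def)
  ultimately show ?thesis by simp
qed

lemma shape13: "horizontal D13" "vertical E13"
  by (simp_all add: horizontal_def vertical_def D13_def E13_def)

lemma not_connected13: "\<not> connected_on edges13 (verts D13)" "\<not> connected_on edges13 (verts E13)"
proof -
  \<comment> \<open>A connected brick would be its own only component.\<close>
  have "Brick {6} {0, 1} \<noteq> D13" "Brick {10, 11, 12} {5} \<noteq> E13"
    by (auto simp: D13_def E13_def)
  then show "\<not> connected_on edges13 (verts D13)" "\<not> connected_on edges13 (verts E13)"
    using component13_6 component13_5 component_bricks_connected[of edges13 D13]
      component_bricks_connected[of edges13 E13] by auto
qed

lemma chain13: "ex13.chain {} [D13, E13] (cols13 \<union> rows13)"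
  by (rule ex13.excessive_decomposition_chain[OF decomposition13]) (simp add: cols13_def)

lemma atomic_decomposition13:
  "atomic_decomposition cols13 rows13 edges13 (atomic_blocks edges13 [D13, E13])"
  using decomposition13 by (auto simp: atomic_decomposition_def)

lemma blocks13:
  "Brick {6} {0, 1} \<in> atomic_blocks edges13 [D13, E13]"
  "Brick {10, 11, 12} {5} \<in> atomic_blocks edges13 [D13, E13]"
  using component13_6 component13_5 by (simp_all add: ex13.atomic_blocks_chain[OF chain13])

lemma atomic13: "K \<in> atomic_blocks edges13 [D13, E13] \<Longrightarrow> atomic edges13 K"
  by (erule ex13.atomic_blocksE[OF chain13]) (rule ex13.component_facts(5))

lemma m_atomic13: "m_atomic edges13 2 (Brick {6} {0, 1})" "m_atomic edges13 3 (Brick {10, 11, 12} {5})"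
proof -
  \<comment> \<open>One side is a single vertex and has no proper nonempty subset. Without holes
    \<open>alpha_p\<close> has its default 0, and the characteristic is the number of
    leaves.\<close>
  have "\<not> hole edges13 (Brick {6} {0, 1}) V" "\<not> hole edges13 (Brick {10, 11, 12} {5}) V" for V
    by (auto simp: hole_def subset_singleton_iff)
  then have "characteristic edges13 (Brick {6} {0, 1}) = 2"
    "characteristic edges13 (Brick {10, 11, 12} {5}) = 3"
    by (simp_all add: characteristic_def alpha_p_def horizontal_def)
  then show "m_atomic edges13 2 (Brick {6} {0, 1})" "m_atomic edges13 3 (Brick {10, 11, 12} {5})"
    using blocks13[THEN atomic13, THEN m_atomic_characteristic] by simp_all
qed

lemma different_regions13:
  "different_regions cols13 rows13 edges13 (Brick {6} {0, 1}) (Brick {10, 11, 12} {5})"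
  by (rule ex13.different_regions_D_E[OF chain13 _ shape13(1) _ shape13(2) component13_6 component13_5])
    simp_all

lemma joined13: "joined edges13 (Brick {6} {0, 1}) (Brick {10, 11, 12} {5})"
  unfolding joined_def by (rule bexI[of _ 6], rule bexI[of _ 5]) (simp_all add: verts_def edges13_iff arcs13_def)

theorem theorem4p2:
  fixes A B :: "'a set" and E :: "'a set set"
  assumes "base_graph A B E"
  shows
    "(\<exists>!\<B>. atomic_decomposition A B E \<B>) \<and>
     (\<forall>\<B>. atomic_decomposition A B E \<B> \<longrightarrow>
       \<comment> \<open>arranged in a BTF\<close>
       (\<exists>L'. btf A B E L' \<and> set L' = \<B>) \<and>

       \<comment> \<open>(1)\<close>
       (\<forall>T\<in>\<B>. \<exists>m>0. m_atomic E m T) \<and>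

       \<comment> \<open>(2)\<close>
       (\<forall>L. excessive_decomposition A B E L \<longrightarrow>
         (\<exists>Ds Cs Es. L = Ds @ Cs @ Es \<and> length Ds \<le> 1 \<and> length Es \<le> 1 \<and>
           btf A B E L \<and>
           (\<forall>T\<in>set L. excessive E T) \<and>
           (\<forall>T\<in>set Ds. horizontal T) \<and>
           (\<forall>T\<in>set Cs. balanced T \<and> connected_on E (verts T) \<and> atomic E T) \<and>
           (\<forall>T\<in>set Es. vertical T) \<and>
           (\<forall>M. maximum_matching E M \<longrightarrow>
              dm_D A B E M = (\<Union>T\<in>set Ds. verts T) \<and>
              dm_C A B E M = (\<Union>T\<in>set Cs. verts T) \<and>
              dm_E A B E M = (\<Union>T\<in>set Es. verts T)) \<and>
           (\<forall>T\<in>set Ds \<union> set Es. \<forall>K\<in>component_bricks E T.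
              is_brick A B K \<and> \<not> balanced K \<and> excessive E K \<and> atomic E K) \<and>
           \<B> = (\<Union>T\<in>set Ds. component_bricks E T) \<union> set Cs
                \<union> (\<Union>T\<in>set Es. component_bricks E T) \<and>
           (\<forall>Dcs Ecs.
              distinct Dcs \<and> set Dcs = (\<Union>T\<in>set Ds. component_bricks E T) \<and>
              distinct Ecs \<and> set Ecs = (\<Union>T\<in>set Es. component_bricks E T) \<longrightarrow>
              btf A B E (Dcs @ Cs @ Ecs)))) \<and>
       (\<forall>M. maximum_matching E M \<longrightarrow> (\<forall>T\<in>\<B>. \<exists>R\<in>dm_regions A B E M. verts T \<subseteq> R)) \<and>

       \<comment> \<open>(3), and the last sentence of (4)\<close>
       (\<forall>S\<in>\<B>. \<forall>T\<in>\<B>. different_regions A B E S T \<longrightarrow>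
          (\<forall>u\<in>verts S. \<forall>v\<in>verts T. {u, v} \<in> E \<longrightarrow>
             (\<forall>M. maximum_matching E M \<longrightarrow> {u, v} \<notin> M))) \<and>

       \<comment> \<open>(4)\<close>
       (\<forall>M. maximum_matching E M \<longrightarrow>
          (\<exists>N. (\<forall>T\<in>\<B>. maximum_matching (induced_edges E T) (N T)) \<and>
               (\<forall>S\<in>\<B>. \<forall>T\<in>\<B>. S \<noteq> T \<longrightarrow> N S \<inter> N T = {}) \<and>
               M = (\<Union>T\<in>\<B>. N T))) \<and>
       (\<forall>T\<in>\<B>. hole_condition E T \<and>
          (\<exists>N. matching (induced_edges E T) N \<and> card N = small T)) \<and>

       \<comment> \<open>(5)\<close>
       (\<forall>M M'. maximum_matching E M \<and> maximum_matching E M' \<longrightarrow>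
          dm_D A B E M = dm_D A B E M' \<and> dm_C A B E M = dm_C A B E M' \<and>
          dm_E A B E M = dm_E A B E M') \<and>
       (\<forall>L L'. excessive_decomposition A B E L \<and> excessive_decomposition A B E L' \<longrightarrow>
          set L = set L' \<and> atomic_blocks E L = atomic_blocks E L') \<and>
       (\<forall>L L'. btf A B E L \<and> set L = \<B> \<longrightarrow>
          (btf A B E L' \<and> set L' = \<B> \<longleftrightarrow> incomparable_permutation E L L'))) \<and>

     \<comment> \<open>the value of m may differ between blocks, as remarked in (1)\<close>
     (\<exists>(A' :: nat set) B' E' \<B> S T m n. base_graph A' B' E' \<and> atomic_decomposition A' B' E' \<B> \<and>
        S \<in> \<B> \<and> T \<in> \<B> \<and> m_atomic E' m S \<and> m_atomic E' n T \<and> m \<noteq> n) \<and>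

     \<comment> \<open>the blocks D and E need not be connected, as remarked in (2)\<close>
     (\<exists>(A' :: nat set) B' E' L T. base_graph A' B' E' \<and> excessive_decomposition A' B' E' L \<and>
        T \<in> set L \<and> horizontal T \<and> \<not> connected_on E' (verts T)) \<and>
     (\<exists>(A' :: nat set) B' E' L T. base_graph A' B' E' \<and> excessive_decomposition A' B' E' L \<and>
        T \<in> set L \<and> vertical T \<and> \<not> connected_on E' (verts T)) \<and>

     \<comment> \<open>edges between atomic blocks from different regions may exist, as remarked in (3)\<close>
     (\<exists>(A' :: nat set) B' E' \<B> S T. base_graph A' B' E' \<and> atomic_decomposition A' B' E' \<B> \<and>
        S \<in> \<B> \<and> T \<in> \<B> \<and> different_regions A' B' E' S T \<and> joined E' S T)"
proof -
  interpret bipartition_full A B E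
    using assms by unfold_locales (auto simp: base_graph_def)
  have ne: "A \<union> B \<noteq> {}" using assms by (auto simp: base_graph_def connected_on_def)
  note chain = excessive_decomposition_chain[OF _ ne]
  have same_set: "set L = set L'"
    if "excessive_decomposition A B E L" "excessive_decomposition A B E L'" for L L'
    using chain_set[OF chain[OF that(1)]] chain_set[OF chain[OF that(2)]] by simp
  have same_blocks: "atomic_blocks E L = atomic_blocks E L'"
    if "excessive_decomposition A B E L" "excessive_decomposition A B E L'" for L L'
    using same_set[OF that] by (simp add: atomic_blocks_def)
  show ?thesis
  proof (intro conjI allI impI)
    obtain L where L: "excessive_decomposition A B E L" using ex_excessive_decomposition[OF ne] by blast
    show "\<exists>!\<B>. atomic_decomposition A B E \<B>"
    proof (rule ex1I)
      show "atomic_decomposition A B E (atomic_blocks E L)"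
        unfolding atomic_decomposition_def using L by blast
      show "\<B> = atomic_blocks E L" if "atomic_decomposition A B E \<B>" for \<B>
        using that same_blocks[OF _ L] unfolding atomic_decomposition_def by blast
    qed
  next
    fix \<B> assume "atomic_decomposition A B E \<B>"
    then obtain L0 where L0: "excessive_decomposition A B E L0" "\<B> = atomic_blocks E L0"
      unfolding atomic_decomposition_def by blast
    note c0 = chain[OF L0(1)]
    show "\<exists>L'. btf A B E L' \<and> set L' = \<B>" unfolding L0(2) by (rule atomic_btf[OF c0])
    have block: "atomic E T \<and> solid E T \<and> (\<exists>N. matching (induced_edges E T) N \<and> card N = small T)"
      if T: "T \<in> \<B>" for T
    proof -
      obtain P Q where "elementary P Q" "T \<in> component_bricks E (brick_of (Q - P))"
        using T unfolding L0(2) by (rule atomic_blocksE[OF c0])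
      then show ?thesis using component_facts(3,5) small_matching by blast
    qed
    show "\<forall>T\<in>\<B>. \<exists>m>0. m_atomic E m T"
      using block by (auto simp: atomic_def m_atomic_def m_excessive_def)
    show "\<forall>T\<in>\<B>. hole_condition E T \<and> (\<exists>N. matching (induced_edges E T) N \<and> card N = small T)"
      using block hole_condition_if_solid by blast
    show "\<forall>T\<in>\<B>. \<exists>R\<in>dm_regions A B E M. verts T \<subseteq> R" if "maximum_matching E M" for M
      using atomic_block_in_region[OF c0 _ that] unfolding L0(2) by blast
    show "\<forall>S\<in>\<B>. \<forall>T\<in>\<B>. different_regions A B E S T \<longrightarrow>
        (\<forall>u\<in>verts S. \<forall>v\<in>verts T. {u, v} \<in> E \<longrightarrow> (\<forall>M. maximum_matching E M \<longrightarrow> {u, v} \<notin> M))"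
      unfolding L0(2) by (intro ballI allI impI) (rule no_matching_between_regions[OF c0])
    show "\<exists>N. (\<forall>T\<in>\<B>. maximum_matching (induced_edges E T) (N T)) \<and>
        (\<forall>S\<in>\<B>. \<forall>T\<in>\<B>. S \<noteq> T \<longrightarrow> N S \<inter> N T = {}) \<and> M = (\<Union>T\<in>\<B>. N T)"
      if "maximum_matching E M" for M
      unfolding L0(2) by (rule matching_decomposition[OF c0 that])
    show "btf A B E L' \<and> set L' = \<B> \<longleftrightarrow> incomparable_permutation E L L'"
      if "btf A B E L \<and> set L = \<B>" for L L'
      using that btf_incomparable_permutation[of L L'] incomparable_permutation_btf[of L L'] by blast
    show "set L = set L'" "atomic_blocks E L = atomic_blocks E L'"
      if "excessive_decomposition A B E L \<and> excessive_decomposition A B E L'" for L L'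
      using that same_set same_blocks by blast+
    \<comment> \<open>\<open>H\<close> and \<open>G\<close> are fixed by the graph alone, and they
      determine the regions of every maximum matching.\<close>
    obtain Ds Cs Es H G where t: "tight H" "\<forall>F. tight F \<longrightarrow> H \<subseteq> F" "tight G" "\<forall>F. tight F \<longrightarrow> F \<subseteq> G"
      by (rule chain_structure[OF c0]) (rule that)
    show "dm_D A B E M = dm_D A B E M'" "dm_C A B E M = dm_C A B E M'" "dm_E A B E M = dm_E A B E M'"
      if "maximum_matching E M \<and> maximum_matching E M'" for M M'
      using regions[OF _ t, of M] regions[OF _ t, of M'] that by simp_all
    fix L assume L: "excessive_decomposition A B E L"
    note c = chain[OF L]
    \<comment> \<open>\<open>\<B>\<close> stems from the run \<open>L0\<close>; the structure is
      claimed for an arbitrary run \<open>L\<close>, so it is expressed through the blocks of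
      \<open>L\<close>.\<close>
    have \<B>: "\<B> = atomic_blocks E L" unfolding L0(2) by (rule same_blocks[OF L0(1) L])
    obtain Ds Cs Es H G where s: "L = Ds @ Cs @ Es" "length Ds \<le> 1" "length Es \<le> 1"
      and t: "tight H" "\<forall>F. tight F \<longrightarrow> H \<subseteq> F" "tight G" "\<forall>F. tight F \<longrightarrow> F \<subseteq> G"
      and h: "\<forall>T\<in>set Ds. horizontal T" "\<forall>T\<in>set Cs. balanced T" "\<forall>T\<in>set Es. vertical T"
      and v: "(\<Union>T\<in>set Ds. verts T) = H" "(\<Union>T\<in>set Cs. verts T) = G - H"
        "(\<Union>T\<in>set Es. verts T) = A \<union> B - G"
      by (rule chain_structure[OF c]) (rule that)
    have el: "\<exists>P Q. elementary P Q \<and> T = brick_of (Q - P)" if T: "T \<in> set L" for T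
      by (rule chain_members[OF c T]) blast
    have comp: "is_brick A B K \<and> excessive E K \<and> atomic E K" "\<not> balanced T \<Longrightarrow> \<not> balanced K"
      if "T \<in> set L" "K \<in> component_bricks E T" for T K
      using el[OF that(1)] that(2) component_facts(1,4,5,6) by blast+
    have exc: "excessive E T" if "T \<in> set L" for T
    proof -
      obtain P Q where PQ: "elementary P Q" "T = brick_of (Q - P)" using el[OF \<open>T \<in> set L\<close>] by blast
      have "row T \<noteq> {}" using is_brick_block[OF PQ(1)] PQ(2) by (simp add: is_brick_def)
      then show ?thesis using block_facts[OF PQ(1)] PQ(2) by (intro excessive_if_solid) simp_all
    qed
    have Cs: "connected_on E (verts T)" "atomic E T" if T: "T \<in> set Cs" for T
    proof -
      obtain P Q where PQ: "elementary P Q" "T = brick_of (Q - P)" using el[of T] T s(1) by auto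
      then show "connected_on E (verts T)" "atomic E T"
        using balanced_block[OF PQ(1)] component_facts(5)[OF PQ(1)] h(2) T by auto
    qed
    have unb: "\<not> balanced T" if "T \<in> set Ds \<union> set Es" for T
      using that h(1,3) unfolding horizontal_def vertical_def balanced_def by force
    show "\<exists>Ds Cs Es. L = Ds @ Cs @ Es \<and> length Ds \<le> 1 \<and> length Es \<le> 1 \<and>
           btf A B E L \<and>
           (\<forall>T\<in>set L. excessive E T) \<and>
           (\<forall>T\<in>set Ds. horizontal T) \<and>
           (\<forall>T\<in>set Cs. balanced T \<and> connected_on E (verts T) \<and> atomic E T) \<and>
           (\<forall>T\<in>set Es. vertical T) \<and>
           (\<forall>M. maximum_matching E M \<longrightarrow>
              dm_D A B E M = (\<Union>T\<in>set Ds. verts T) \<and>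
              dm_C A B E M = (\<Union>T\<in>set Cs. verts T) \<and>
              dm_E A B E M = (\<Union>T\<in>set Es. verts T)) \<and>
           (\<forall>T\<in>set Ds \<union> set Es. \<forall>K\<in>component_bricks E T.
              is_brick A B K \<and> \<not> balanced K \<and> excessive E K \<and> atomic E K) \<and>
           \<B> = (\<Union>T\<in>set Ds. component_bricks E T) \<union> set Cs
                \<union> (\<Union>T\<in>set Es. component_bricks E T) \<and>
           (\<forall>Dcs Ecs.
              distinct Dcs \<and> set Dcs = (\<Union>T\<in>set Ds. component_bricks E T) \<and>
              distinct Ecs \<and> set Ecs = (\<Union>T\<in>set Es. component_bricks E T) \<longrightarrow>
              btf A B E (Dcs @ Cs @ Ecs))"
    proof (rule exI[of _ Ds], rule exI[of _ Cs], rule exI[of _ Es], intro conjI)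
      show "\<forall>T\<in>set Cs. balanced T \<and> connected_on E (verts T) \<and> atomic E T" using h(2) Cs by blast
      show "\<forall>M. maximum_matching E M \<longrightarrow>
          dm_D A B E M = (\<Union>T\<in>set Ds. verts T) \<and> dm_C A B E M = (\<Union>T\<in>set Cs. verts T) \<and>
          dm_E A B E M = (\<Union>T\<in>set Es. verts T)"
        unfolding v using regions[OF _ t] by blast
      show "\<forall>T\<in>set Ds \<union> set Es. \<forall>K\<in>component_bricks E T.
          is_brick A B K \<and> \<not> balanced K \<and> excessive E K \<and> atomic E K"
      proof (intro ballI)
        fix T K assume T: "T \<in> set Ds \<union> set Es" and K: "K \<in> component_bricks E T"
        have "T \<in> set L" using T s(1) by auto
        then show "is_brick A B K \<and> \<not> balanced K \<and> excessive E K \<and> atomic E K"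
          using comp(1)[OF _ K] comp(2)[OF _ K unb[OF T]] by blast
      qed
      show "\<B> = (\<Union>T\<in>set Ds. component_bricks E T) \<union> set Cs \<union> (\<Union>T\<in>set Es. component_bricks E T)"
        unfolding \<B> by (rule atomic_blocks_parts[OF c s(1) h(2)])
      show "\<forall>Dcs Ecs. distinct Dcs \<and> set Dcs = (\<Union>T\<in>set Ds. component_bricks E T) \<and>
          distinct Ecs \<and> set Ecs = (\<Union>T\<in>set Es. component_bricks E T) \<longrightarrow> btf A B E (Dcs @ Cs @ Ecs)"
        using refined_btf[OF c s h(2)] by simp
      show "btf A B E L" by (rule chain_is_btf[OF c])
      show "\<forall>T\<in>set L. excessive E T" using exc by blast
    qed (rule s h)+
  next
    show "\<exists>(A' :: nat set) B' E' \<B> S T m n. base_graph A' B' E' \<and> atomic_decomposition A' B' E' \<B> \<and>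
        S \<in> \<B> \<and> T \<in> \<B> \<and> m_atomic E' m S \<and> m_atomic E' n T \<and> m \<noteq> n"
      using base13 atomic_decomposition13 blocks13 m_atomic13 by (metis numeral_eq_iff semiring_norm(89))
    show "\<exists>(A' :: nat set) B' E' L T. base_graph A' B' E' \<and> excessive_decomposition A' B' E' L \<and>
        T \<in> set L \<and> horizontal T \<and> \<not> connected_on E' (verts T)"
      using base13 decomposition13 shape13(1) not_connected13(1)
      by (intro exI[of _ cols13] exI[of _ rows13] exI[of _ edges13] exI[of _ "[D13, E13]"] exI[of _ D13]) simp
    show "\<exists>(A' :: nat set) B' E' L T. base_graph A' B' E' \<and> excessive_decomposition A' B' E' L \<and>
        T \<in> set L \<and> vertical T \<and> \<not> connected_on E' (verts T)"
      using base13 decomposition13 shape13(2) not_connected13(2)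
      by (intro exI[of _ cols13] exI[of _ rows13] exI[of _ edges13] exI[of _ "[D13, E13]"] exI[of _ E13]) simp
    show "\<exists>(A' :: nat set) B' E' \<B> S T. base_graph A' B' E' \<and> atomic_decomposition A' B' E' \<B> \<and>
        S \<in> \<B> \<and> T \<in> \<B> \<and> different_regions A' B' E' S T \<and> joined E' S T"
      using base13 atomic_decomposition13 blocks13 different_regions13 joined13 by blast
  qed
qed

end
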